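(* Let $\mathbf G,\mathbf G'$ be graphs such that there is a $\mathbb Z_2$-map from $|\mathrm{Hom}(\mathbf K_2,\mathbf G)|$ to $|\mathrm{Hom}(\mathbf K_2,\mathbf G')|$, and suppose $\mathrm{PCSP}(\mathbf H,\mathbf G')$ is NP-hard for all non-bipartite graphs $\mathbf H$ such that $\mathbf H\to\mathbf G'$. Then $\mathrm{PCSP}(\mathbf H,\mathbf G)$ is NP-hard for all non-bipartite graphs $\mathbf H$ such that $\mathbf H\to\mathbf G$.
   Context: Graphs are finite and undirected (each edge present as both ordered pairs). A homomorphism $\mathbf H\to\mathbf G$ is a vertex map sending edges to edges. For graphs $\mathbf H\to\mathbf G$, $\mathrm{PCSP}(\mathbf H,\mathbf G)$ is the promise decision problem: given a finite graph $\mathbf I$ such that either $\mathbf I\to\mathbf H$ or $\mathbf I\not\to\mathbf G$, output YES in the former case and NO in the latter. $\mathrm{Hom}(\mathbf K_2,\mathbf G)$ is the abstract simplicial complex whose vertices are the oriented edges $(u,v)\in E(G)$, where a non-empty set $\sigma$ of oriented edges is a face iff there are $U,V\subseteq V(G)$ with $\sigma\subseteq U\times V\subseteq E(G)$; it carries the involution $-(u,v)=(v,u)$, which is a simplicial map. $|\mathrm{Hom}(\mathbf K_2,\mathbf G)|$ denotes its geometric realisation, with the involution extended affinely on faces. A $\mathbb Z_2$-map between spaces with involutions is a continuous map $f$ with $f(-x)=-f(x)$. *)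

theory Defs
  imports "HOL-Analysis.Analysis" "Graph_Theory.Pair_Digraph"
begin

section \<open>Graphs\<close>

text \<open>
  A finite undirected graph, each edge being present as both ordered pairs, is a
  \<^const>\<open>pair_pseudo_graph\<close>; loops are permitted.
\<close>

definition graph_hom :: "'a pair_pre_digraph \<Rightarrow> 'b pair_pre_digraph \<Rightarrow> ('a \<Rightarrow> 'b) \<Rightarrow> bool" where
  "graph_hom H G f \<longleftrightarrow>
     f ` pverts H \<subseteq> pverts G \<and> (\<forall>u v. (u, v) \<in> parcs H \<longrightarrow> (f u, f v) \<in> parcs G)"

definition homomorphic :: "'a pair_pre_digraph \<Rightarrow> 'b pair_pre_digraph \<Rightarrow> bool" where
  "homomorphic H G \<longleftrightarrow> (\<exists>f. graph_hom H G f)"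

definition bipartite :: "'a pair_pre_digraph \<Rightarrow> bool" where
  "bipartite G \<longleftrightarrow>
     (\<exists>A B. A \<inter> B = {} \<and> A \<union> B = pverts G \<and> parcs G \<subseteq> A \<times> B \<union> B \<times> A)"


section \<open>The complex of homomorphisms from an edge\<close>

definition hom_complex :: "'a pair_pre_digraph \<Rightarrow> ('a \<times> 'a) set set" where
  "hom_complex G =
     {\<sigma>. \<sigma> \<noteq> {} \<and>
         (\<exists>U V. U \<subseteq> pverts G \<and> V \<subseteq> pverts G \<and> \<sigma> \<subseteq> U \<times> V \<and> U \<times> V \<subseteq> parcs G)}"

text \<open>
  Points of the geometric realisation are given by barycentric coordinates.
  The function space carries the product topology; when there are only finitely many
  vertices, the subspace topology on the realisation is the Euclidean one.
\<close>

definition realisation :: "'v set set \<Rightarrow> ('v \<Rightarrow> real) set" where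
  "realisation K =
     {x. (\<forall>v. 0 \<le> x v) \<and> {v. x v \<noteq> 0} \<in> K \<and> (\<Sum>v | x v \<noteq> 0. x v) = 1}"

text \<open>
  The affine extension of \<open>(u, v) \<mapsto> (v, u)\<close> sends \<open>\<Sum>\<^sub>e x\<^sub>e e\<close> to \<open>\<Sum>\<^sub>e x\<^sub>e (-e)\<close>,
  whose coordinate at an oriented edge is the coordinate of \<open>x\<close> at the reversed edge.
\<close>

definition flip :: "('a \<times> 'a \<Rightarrow> real) \<Rightarrow> ('a \<times> 'a \<Rightarrow> real)" where
  "flip x = (\<lambda>(u, v). x (v, u))"

definition Z2_map ::
  "'x::topological_space set \<Rightarrow> ('x \<Rightarrow> 'x) \<Rightarrow> 'y::topological_space set \<Rightarrow> ('y \<Rightarrow> 'y) \<Rightarrow> ('x \<Rightarrow> 'y) \<Rightarrow> bool"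
where
  "Z2_map X \<nu> Y \<mu> f \<longleftrightarrow>
     continuous_on X f \<and> f ` X \<subseteq> Y \<and> (\<forall>x\<in>X. f (\<nu> x) = \<mu> (f x))"


section \<open>Polynomial time and NP-hardness\<close>

text \<open>
  Deterministic multi-tape Turing machines over the tape alphabet consisting of
  a blank (\<^const>\<open>None\<close>) and the two bits. Tapes are infinite in both directions and
  their cells are indexed relative to the head, which thus always scans cell 0.
  The control states are \<open>0, \<dots>, num_states M\<close>, where \<open>0\<close> is initial and
  \<open>num_states M\<close> is the halting state.
\<close>

type_synonym symbol = "bool option"
type_synonym tape = "int \<Rightarrow> symbol"

datatype move = Go_Left | Stay | Go_Right

record tm =
  num_tapes :: nat
  num_states :: nat
  trans :: "nat \<Rightarrow> symbol list \<Rightarrow> nat \<times> (symbol \<times> move) list"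

definition tm_wf :: "tm \<Rightarrow> bool" where
  "tm_wf M \<longleftrightarrow> 0 < num_tapes M \<and>
     (\<forall>q ss. q < num_states M \<and> length ss = num_tapes M \<longrightarrow>
        fst (trans M q ss) \<le> num_states M \<and> length (snd (trans M q ss)) = num_tapes M)"

fun shift_tape :: "move \<Rightarrow> tape \<Rightarrow> tape" where
  "shift_tape Go_Left t = (\<lambda>i. t (i - 1))"
| "shift_tape Stay t = t"
| "shift_tape Go_Right t = (\<lambda>i. t (i + 1))"

definition act :: "symbol \<times> move \<Rightarrow> tape \<Rightarrow> tape" where
  "act a t = shift_tape (snd a) (t(0 := fst a))"

definition tm_step :: "tm \<Rightarrow> nat \<times> tape list \<Rightarrow> nat \<times> tape list" where
  "tm_step M = (\<lambda>(q, ts).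
     if q < num_states M
     then let (q', as) = trans M q (map (\<lambda>t. t 0) ts) in (q', map2 act as ts)
     else (q, ts))"

definition tape_of :: "bool list \<Rightarrow> tape" where
  "tape_of w = (\<lambda>i. if 0 \<le> i \<and> i < int (length w) then Some (w ! nat i) else None)"

definition tm_start :: "tm \<Rightarrow> bool list \<Rightarrow> nat \<times> tape list" where
  "tm_start M w = (0, tape_of w # replicate (num_tapes M - 1) (tape_of []))"

text \<open>
  The input is given on the first tape; on halting, that tape holds just the output,
  with the head on its first cell. The other tapes may hold anything.
\<close>

definition poly_time :: "(bool list \<Rightarrow> bool list) \<Rightarrow> bool" where
  "poly_time f \<longleftrightarrow>
     (\<exists>M c d. tm_wf M \<and>
        (\<forall>w. \<exists>n ts. n \<le> c * length w ^ d + c \<and>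
           (tm_step M ^^ n) (tm_start M w) = (num_states M, tape_of (f w) # ts)))"

definition pair_code :: "bool list \<Rightarrow> bool list \<Rightarrow> bool list" where
  "pair_code w y = concat (map (\<lambda>b. [True, b]) w) @ False # y"

definition in_NP :: "bool list set \<Rightarrow> bool" where
  "in_NP L \<longleftrightarrow>
     (\<exists>verify c d. poly_time verify \<and>
        (\<forall>w. w \<in> L \<longleftrightarrow>
           (\<exists>y. length y \<le> c * length w ^ d + c \<and> verify (pair_code w y) = [True])))"

text \<open>
  A promise problem is the pair of its YES-instances and its NO-instances.
  NP-hardness refers to polynomial-time many-one reductions.
\<close>

type_synonym promise_problem = "bool list set \<times> bool list set"

definition NP_hard :: "promise_problem \<Rightarrow> bool" where
  "NP_hard P \<longleftrightarrow>
     (\<forall>L. in_NP L \<longrightarrow>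
        (\<exists>f. poly_time f \<and> (\<forall>w. (w \<in> L \<longrightarrow> f w \<in> fst P) \<and> (w \<notin> L \<longrightarrow> f w \<in> snd P))))"


section \<open>Promise constraint satisfaction problems\<close>

text \<open>
  Instances are graphs on an initial segment of the natural numbers, presented as
  the number of vertices in unary followed by the adjacency matrix, row by row.
\<close>

definition instance_graph :: "nat pair_pre_digraph \<Rightarrow> bool" where
  "instance_graph I \<longleftrightarrow> pair_pseudo_graph I \<and> (\<exists>n. pverts I = {..<n})"

definition graph_code :: "nat pair_pre_digraph \<Rightarrow> bool list" where
  "graph_code I =
     (let n = card (pverts I) in
        replicate n True @ False #
        concat (map (\<lambda>u. map (\<lambda>v. (u, v) \<in> parcs I) [0..<n]) [0..<n]))"

definition PCSP :: "'a pair_pre_digraph \<Rightarrow> 'b pair_pre_digraph \<Rightarrow> promise_problem" where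
  "PCSP H G =
     ({graph_code I |I. instance_graph I \<and> homomorphic I H},
      {graph_code I |I. instance_graph I \<and> \<not> homomorphic I G})"

end

theory Submission
  imports Defs
begin

text \<open>
  Write \<open>\<Gamma> I\<close> for the graph on the vertices of \<open>I\<close> whose arcs are the walks of length 3 in \<open>I\<close>
  (\<open>cube_graph\<close> below), so that \<open>\<Gamma>\<^sup>j I\<close> records the walks of length \<open>3\<^sup>j\<close>.

  A homomorphism \<open>\<Gamma>\<^sup>j I \<rightarrow> G\<close> with \<open>3\<^sup>j = 2l + 1\<close> makes the images of the endpoints of walks of length \<open>l\<close>
  and \<open>l + 1\<close> from a vertex \<open>i\<close> of \<open>I\<close> completely joined in \<open>G\<close>. Weighting a vertex of \<open>G\<close> by the number of
  lengths at which it is reached gives a point \<open>x\<^sub>i\<close> of \<open>|Hom(K\<^sub>2, G)|\<close>. For adjacent \<open>i, i'\<close> the two weights differ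
  by at most one, hence \<open>x\<^sub>i\<close> and \<open>-x\<^sub>i\<^sub>'\<close> are close if \<open>j\<close> is large. By uniform continuity their images under the
  \<open>\<int>\<^sub>2\<close>-map are close too, and sending \<open>i\<close> to the tail of an oriented edge that carries a large coordinate
  of the image of \<open>x\<^sub>i\<close> is a homomorphism \<open>I \<rightarrow> G'\<close>.

  So for suitable \<open>j\<close>, \<open>\<Gamma>\<^sup>j I \<rightarrow> G\<close> implies \<open>I \<rightarrow> G'\<close>. Subdividing each edge of \<open>H\<close> into three, \<open>j\<close> times,
  yields a non-bipartite \<open>H'\<close> with \<open>\<Gamma>\<^sup>j H' \<rightarrow> H \<rightarrow> G\<close>, hence \<open>H' \<rightarrow> G'\<close>, and \<open>I \<mapsto> \<Gamma>\<^sup>j I\<close> is a polynomial-time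
  reduction from \<open>PCSP(H', G')\<close> to \<open>PCSP(H, G)\<close>.
\<close>

section \<open>Programming with Turing machines\<close>

text \<open>
  Halted configurations are fixed points of \<^const>\<open>tm_step\<close>, so the number of steps before halting
  is not determined by its powers. The relation below only counts steps from non-halting states, as is
  needed to chain machines.
\<close>

inductive tm_run :: "tm \<Rightarrow> nat \<times> tape list \<Rightarrow> nat \<Rightarrow> nat \<times> tape list \<Rightarrow> bool" for M where
  refl: "tm_run M c 0 c"
| step: "fst c < num_states M \<Longrightarrow> tm_run M (tm_step M c) n c' \<Longrightarrow> tm_run M c (Suc n) c'"

lemma tm_run_imp_funpow: "tm_run M c n c' \<Longrightarrow> (tm_step M ^^ n) c = c'"
  by (induction rule: tm_run.induct) (simp_all add: funpow_swap1)

lemma funpow_imp_tm_run: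
  "(tm_step M ^^ n) c = (num_states M, ts) \<Longrightarrow> \<exists>m\<le>n. tm_run M c m (num_states M, ts)"
proof (induction n arbitrary: c)
  case 0
  then show ?case by (auto intro: tm_run.refl)
next
  case (Suc n)
  show ?case
  proof (cases "fst c < num_states M")
    case True
    have "(tm_step M ^^ n) (tm_step M c) = (num_states M, ts)"
      using Suc.prems by (simp add: funpow_swap1)
    then obtain m where "m \<le> n" "tm_run M (tm_step M c) m (num_states M, ts)"
      using Suc.IH by blast
    then show ?thesis using True by (meson Suc_le_mono tm_run.step)
  next
    case False
    then have "tm_step M c = c" by (cases c) (simp add: tm_step_def)
    then have "(tm_step M ^^ n) c = (num_states M, ts)"
      using Suc.prems by (simp add: funpow_swap1)
    then show ?thesis using Suc.IH le_SucI by blast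
  qed
qed

lemma tm_run_trans: "tm_run M c m c' \<Longrightarrow> tm_run M c' n c'' \<Longrightarrow> tm_run M c (m + n) c''"
  by (induction rule: tm_run.induct) (auto intro: tm_run.intros)

text \<open>The simulation condition only concerns configurations in which \<open>M\<close> has not
  halted, so \<open>\<phi>\<close> may send the halting state of \<open>M\<close> to a working state
  of \<open>M'\<close>. This is what lets machines be chained.\<close>

lemma tm_run_simulate:
  assumes "tm_run M c n c'" and "I c"
    and "\<And>c. I c \<Longrightarrow> fst c < num_states M \<Longrightarrow>
           I (tm_step M c) \<and> fst (\<phi> c) < num_states M' \<and> tm_step M' (\<phi> c) = \<phi> (tm_step M c)"
  shows "tm_run M' (\<phi> c) n (\<phi> c')"
  using assms(1,2) by induction (auto intro: tm_run.intros simp: assms(3))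

section \<open>Machine combinators and their running times\<close>

definition halts_within :: "tm \<Rightarrow> tape list \<Rightarrow> tape list \<Rightarrow> nat \<Rightarrow> bool" where
  "halts_within M ts ts' t \<longleftrightarrow> (\<exists>n\<le>t. tm_run M (0, ts) n (num_states M, ts'))"

lemma halts_within_mono: "halts_within M ts ts' t \<Longrightarrow> t \<le> t' \<Longrightarrow> halts_within M ts ts' t'"
  unfolding halts_within_def by (meson order_trans)

definition tm_prim :: "nat \<Rightarrow> (symbol list \<Rightarrow> (symbol \<times> move) list) \<Rightarrow> tm" where
  "tm_prim k g = \<lparr>num_tapes = k, num_states = 1, trans = (\<lambda>q ss. (1, g ss))\<rparr>"

text \<open>The halting state of \<open>M1\<close> has the very number that state 0 of
  \<open>M2\<close> receives, so control passes without a linking step.\<close>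

definition tm_seq :: "tm \<Rightarrow> tm \<Rightarrow> tm" (infixl \<open>;;\<close> 60) where
  "M1 ;; M2 = \<lparr>num_tapes = num_tapes M1, num_states = num_states M1 + num_states M2,
     trans = (\<lambda>q ss. if q < num_states M1 then trans M1 q ss
        else map_prod (\<lambda>q. q + num_states M1) id (trans M2 (q - num_states M1) ss))\<rparr>"

text \<open>State 0 performs the test; the states of the body are shifted up by one and its halting
  state is identified with 0. If \<open>num_states M = 0\<close>, the body starts out halted, so its
  start is already state 0.\<close>

definition tm_while :: "(symbol list \<Rightarrow> bool) \<Rightarrow> tm \<Rightarrow> tm" where
  "tm_while c M = \<lparr>num_tapes = num_tapes M, num_states = Suc (num_states M),
     trans = (\<lambda>q ss. if q = 0 then (if c ss then (if num_states M = 0 then 0 else 1) else Suc (num_states M), map (\<lambda>s. (s, Stay)) ss)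
        else map_prod (\<lambda>q. if q = num_states M then 0 else Suc q) id (trans M (q - 1) ss))\<rparr>"

lemma tm_wf_prim: "0 < k \<Longrightarrow> (\<And>ss. length ss = k \<Longrightarrow> length (g ss) = k) \<Longrightarrow> tm_wf (tm_prim k g)"
  by (auto simp: tm_wf_def tm_prim_def)

lemma tm_wf_seq:
  assumes "tm_wf M1" "tm_wf M2" "num_tapes M1 = num_tapes M2"
  shows "tm_wf (M1 ;; M2)"
  using assms unfolding tm_wf_def tm_seq_def
  by (auto simp: less_diff_conv2 intro: trans_le_add1)

lemma tm_wf_while: "tm_wf M \<Longrightarrow> tm_wf (tm_while c M)"
  unfolding tm_wf_def tm_while_def
  by (auto simp: less_diff_conv2)

lemma num_tapes_simps [simp]:
  "num_tapes (tm_prim k g) = k" "num_tapes (M1 ;; M2) = num_tapes M1" "num_tapes (tm_while c M) = num_tapes M"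
  by (simp_all add: tm_prim_def tm_seq_def tm_while_def)

lemma halts_within_prim:
  "halts_within (tm_prim k g) ts (map2 act (g (map (\<lambda>t. t 0) ts)) ts) 1"
proof -
  have "tm_run (tm_prim k g) (0, ts) (Suc 0) (1, map2 act (g (map (\<lambda>t. t 0) ts)) ts)"
    by (rule tm_run.step) (auto simp: tm_prim_def tm_step_def intro: tm_run.refl)
  then show ?thesis by (auto simp: halts_within_def tm_prim_def)
qed

lemma halts_within_seq [trans]:
  assumes "halts_within M1 ts ts' m" "halts_within M2 ts' ts'' n"
  shows "halts_within (M1 ;; M2) ts ts'' (m + n)"
proof -
  let ?M = "M1 ;; M2"
  from assms obtain m' n' where le: "m' \<le> m" "n' \<le> n"
    and 1: "tm_run M1 (0, ts) m' (num_states M1, ts')"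
    and 2: "tm_run M2 (0, ts') n' (num_states M2, ts'')"
    unfolding halts_within_def by blast
  have "tm_run ?M (id (0, ts)) m' (id (num_states M1, ts'))"
    by (rule tm_run_simulate[OF 1, where I = "\<lambda>_. True"])
       (auto simp: tm_seq_def tm_step_def split: prod.splits)
  moreover have "tm_run ?M (map_prod (\<lambda>q. q + num_states M1) id (0, ts')) n'
      (map_prod (\<lambda>q. q + num_states M1) id (num_states M2, ts''))"
    by (rule tm_run_simulate[OF 2, where I = "\<lambda>_. True"])
       (auto simp: tm_seq_def tm_step_def Let_def split: prod.splits)
  ultimately have "tm_run ?M (0, ts) (m' + n') (num_states ?M, ts'')"
    using tm_run_trans by (fastforce simp: tm_seq_def add.commute)
  then show ?thesis using le unfolding halts_within_def by (meson add_mono)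
qed

lemma act_Stay [simp]: "act (t 0, Stay) t = t"
  by (simp add: act_def)

lemma map2_act_Stay [simp]: "map2 act (map ((\<lambda>s. (s, Stay)) \<circ> (\<lambda>t. t 0)) ts) ts = ts"
  by (induction ts) auto

text \<open>\<open>S i\<close> lists the tapes before round \<open>i\<close>. A round costs its test
  and at most \<open>b\<close> steps; the failing test costs one more.\<close>

lemma halts_within_while:
  assumes "\<And>i. i < m \<Longrightarrow> c (map (\<lambda>t. t 0) (S i))" "\<not> c (map (\<lambda>t. t 0) (S m))"
    and "\<And>i. i < m \<Longrightarrow> halts_within M (S i) (S (Suc i)) b"
  shows "halts_within (tm_while c M) (S 0) (S m) (m * (b + 1) + 1)"
proof -
  let ?W = "tm_while c M"
  have "\<exists>n \<le> i * (b + 1). tm_run ?W (0, S 0) n (0, S i)" if "i \<le> m" for i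
    using that
  proof (induction i)
    case 0
    then show ?case by (auto intro: tm_run.refl)
  next
    case (Suc i)
    then obtain n where n: "n \<le> i * (b + 1)" "tm_run ?W (0, S 0) n (0, S i)" by auto
    from assms(3)[of i] Suc.prems obtain n' where
      n': "n' \<le> b" "tm_run M (0, S i) n' (num_states M, S (Suc i))"
      unfolding halts_within_def by auto
    let ?\<rho> = "map_prod (\<lambda>q. if q = num_states M then 0 else Suc q) id :: nat \<times> tape list \<Rightarrow> _"
    have sim: "tm_run ?W (?\<rho> (0, S i)) n' (?\<rho> (num_states M, S (Suc i)))"
      by (rule tm_run_simulate[OF n'(2), where I = "\<lambda>_. True"])
         (auto simp: tm_while_def tm_step_def Let_def split: prod.splits)
    have "tm_step ?W (0, S i) = ?\<rho> (0, S i)"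
      using assms(1)[of i] Suc.prems
      by (auto simp: tm_step_def tm_while_def)
    with sim have "tm_run ?W (0, S i) (Suc n') (0, S (Suc i))"
      by (intro tm_run.step) (auto simp: tm_while_def)
    from tm_run_trans[OF n(2) this] n(1) n'(1) show ?case
      by (intro exI[of _ "n + Suc n'"]) auto
  qed
  from this[of m] obtain n where n: "n \<le> m * (b + 1)" "tm_run ?W (0, S 0) n (0, S m)" by auto
  have "tm_step ?W (0, S m) = (num_states ?W, S m)"
    using assms(2) by (auto simp: tm_step_def tm_while_def)
  then have "tm_run ?W (0, S m) (Suc 0) (num_states ?W, S m)"
    by (intro tm_run.step) (auto simp: tm_while_def intro: tm_run.refl)
  from tm_run_trans[OF n(2) this] n(1) show ?thesis
    unfolding halts_within_def by (intro exI[of _ "n + Suc 0"]) auto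
qed

text \<open>Keeps tape 0 and inserts \<open>i\<close> idle tapes directly after it and \<open>j\<close> idle tapes at the end.\<close>

definition tm_embed :: "nat \<Rightarrow> nat \<Rightarrow> tm \<Rightarrow> tm" where
  "tm_embed i j M = \<lparr>num_tapes = num_tapes M + i + j, num_states = num_states M,
     trans = (\<lambda>q ss. let k = num_tapes M - 1 in
       case trans M q (hd ss # take k (drop (Suc i) ss)) of (q', as) \<Rightarrow>
         (q', hd as # map (\<lambda>s. (s, Stay)) (take i (tl ss)) @ tl as @
              map (\<lambda>s. (s, Stay)) (drop (Suc (i + k)) ss)))\<rparr>"

lemma num_tapes_embed [simp]: "num_tapes (tm_embed i j M) = num_tapes M + i + j"
  by (simp add: tm_embed_def)

lemma tm_wf_embed: assumes "tm_wf M" shows "tm_wf (tm_embed i j M)"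
  unfolding tm_wf_def
proof (intro conjI allI impI)
  show "0 < num_tapes (tm_embed i j M)" using assms by (simp add: tm_wf_def)
next
  fix q and ss :: "symbol list" assume q: "q < num_states (tm_embed i j M) \<and> length ss = num_tapes (tm_embed i j M)"
  let ?r = "hd ss # take (num_tapes M - 1) (drop (Suc i) ss)"
  have pos: "0 < num_tapes M" using assms by (simp add: tm_wf_def)
  have l: "length ?r = num_tapes M" using q pos by (auto simp: tm_embed_def)
  have w: "fst (trans M q ?r) \<le> num_states M" "length (snd (trans M q ?r)) = num_tapes M"
    using assms q l unfolding tm_wf_def by (auto simp: tm_embed_def)
  show "fst (trans (tm_embed i j M) q ss) \<le> num_states (tm_embed i j M)"
    using w(1) by (auto simp: tm_embed_def Let_def split: prod.splits)
  show "length (snd (trans (tm_embed i j M) q ss)) = num_tapes (tm_embed i j M)"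
    using w(2) q pos by (auto simp: tm_embed_def Let_def split: prod.splits)
qed

lemma tm_step_eq:
  assumes "fst c < num_states M"
  shows "tm_step M c =
    (let (q, as) = trans M (fst c) (map (\<lambda>t. t 0) (snd c)) in (q, map2 act as (snd c)))"
  using assms by (cases c) (simp add: tm_step_def)

lemma length_tm_step:
  assumes "tm_wf M" "length (snd c) = num_tapes M"
  shows "length (snd (tm_step M c)) = num_tapes M"
proof (cases "fst c < num_states M")
  case True
  let ?tr = "trans M (fst c) (map (\<lambda>t. t 0) (snd c))"
  have "length (snd ?tr) = num_tapes M" using assms True unfolding tm_wf_def by auto
  moreover have "tm_step M c = (fst ?tr, map2 act (snd ?tr) (snd c))"
    using True by (simp add: tm_step_eq case_prod_beta)
  ultimately show ?thesis using assms(2) by simp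
next
  case False
  then show ?thesis using assms(2) by (cases c) (simp add: tm_step_def)
qed

lemma tm_run_length:
  assumes "tm_wf M" "tm_run M c n c'" "length (snd c) = num_tapes M"
  shows "length (snd c') = num_tapes M"
  using assms(2,3) by induction (auto simp: length_tm_step[OF assms(1)])

lemma halts_within_embed:
  assumes "tm_wf M" "halts_within M (t # ts) (t' # ts') n" "length (t # ts) = num_tapes M"
    and "length pre = i" "length post = j"
  shows "halts_within (tm_embed i j M) (t # pre @ ts @ post) (t' # pre @ ts' @ post) n"
proof -
  let ?\<phi> = "map_prod id (\<lambda>ts. hd ts # pre @ tl ts @ post) :: nat \<times> tape list \<Rightarrow> _"
  from assms(2) obtain n' where n': "n' \<le> n" "tm_run M (0, t # ts) n' (num_states M, t' # ts')"
    unfolding halts_within_def by auto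
  have "tm_run (tm_embed i j M) (?\<phi> (0, t # ts)) n' (?\<phi> (num_states M, t' # ts'))"
  \<comment> \<open>The embedded machine finds its tapes by position, so their number has to be an
    invariant.\<close>
  proof (rule tm_run_simulate[OF n'(2), where I = "\<lambda>c. length (snd c) = num_tapes M"])
    show "length (snd (0 :: nat, t # ts)) = num_tapes M" using assms(3) by simp
  next
    fix c :: "nat \<times> tape list"
    assume c: "length (snd c) = num_tapes M" "fst c < num_states M"
    have pos: "0 < num_tapes M" using assms(1) by (simp add: tm_wf_def)
    with c(1) obtain q x xs where cq: "c = (q, x # xs)" 
      by (metis length_0_conv less_numeral_extra(3) list.exhaust prod.collapse)
    obtain q' as where tr: "trans M q (map (\<lambda>t. t 0) (x # xs)) = (q', as)" by fastforce
    have "length as = num_tapes M" 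
      using assms(1) c tr cq unfolding tm_wf_def by (metis fst_conv length_map snd_conv)
    with pos obtain y ys where as: "as = y # ys" by (metis length_0_conv less_numeral_extra(3) list.exhaust)
    have len: "length ys = length xs" "num_tapes M - 1 = length xs"
      using \<open>length as = num_tapes M\<close> as c(1) cq by auto
    have "tm_step M c = (q', act y x # map2 act ys xs)"
      using c cq tr as by (simp add: tm_step_def)
    moreover have "tm_step (tm_embed i j M) (?\<phi> c) = (q', act y x # pre @ map2 act ys xs @ post)"
      using c cq tr as len assms(4,5)
      by (simp add: tm_step_def tm_embed_def Let_def)
    moreover have "num_states (tm_embed i j M) = num_states M" by (simp add: tm_embed_def)
    ultimately show "length (snd (tm_step M c)) = num_tapes M \<and> fst (?\<phi> c) < num_states (tm_embed i j M) \<and>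
        tm_step (tm_embed i j M) (?\<phi> c) = ?\<phi> (tm_step M c)"
      using c cq len pos by auto
  qed
  then show ?thesis using n'(1) by (auto simp: halts_within_def tm_embed_def)
qed

text \<open>A write changes one cell, and a move only translates the tape.\<close>

lemma card_nonblank_act:
  assumes "finite {i. t i \<noteq> None}"
  shows "finite {i. act a t i \<noteq> None} \<and> card {i. act a t i \<noteq> None} \<le> Suc (card {i. t i \<noteq> None})"
proof -
  obtain s m where a: "a = (s, m)" by fastforce
  let ?B = "{i. (t(0 := s)) i \<noteq> None}"
  have sub: "?B \<subseteq> insert 0 {i. t i \<noteq> None}" by auto
  then have fin: "finite ?B" using assms by (meson finite_insert finite_subset)
  have card: "card ?B \<le> Suc (card {i. t i \<noteq> None})"
    using card_mono[OF _ sub] assms card_insert_le_m1[of "Suc (card {i. t i \<noteq> None})" "{i. t i \<noteq> None}" 0]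
    by (auto simp del: not_None_eq fun_upd_apply intro: order_trans)
  \<comment> \<open>The new tape is the written one read at offset \<open>d\<close>, so its
    non-blank cells form a translate of \<open>?B\<close>.\<close>
  obtain d where "act a t = (\<lambda>i. (t(0 := s)) (i + d))"
  proof (cases m)
    case Go_Left then show ?thesis using that[of "-1"] by (simp add: act_def a)
  next
    case Stay then show ?thesis using that[of 0] by (simp add: act_def a del: fun_upd_apply)
  next
    case Go_Right then show ?thesis using that[of 1] by (simp add: act_def a)
  qed
  then have act: "\<And>i. act a t i = (t(0 := s)) (i + d)" by simp
  have "{i. act a t i \<noteq> None} = (\<lambda>i. i - d) ` ?B"
  proof (intro equalityI subsetI)
    fix i assume "i \<in> {i. act a t i \<noteq> None}"
    then have "i + d \<in> ?B" unfolding act by simp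
    then show "i \<in> (\<lambda>i. i - d) ` ?B" by (rule rev_image_eqI) simp
  qed (auto simp only: act diff_add_cancel)
  moreover have "card ((\<lambda>i. i - d) ` ?B) \<le> Suc (card {i. t i \<noteq> None})"
    using card_image_le[OF fin] card by (rule order_trans)
  ultimately show ?thesis using fin by (simp only: finite_imageI simp_thms)
qed

lemma card_nonblank_run:
  assumes "tm_wf M" "tm_run M c n c'" "length (snd c) = num_tapes M" "finite {i. hd (snd c) i \<noteq> None}"
  shows "finite {i. hd (snd c') i \<noteq> None} \<and> card {i. hd (snd c') i \<noteq> None} \<le> card {i. hd (snd c) i \<noteq> None} + n"
  using assms(2-)
proof (induction)
  case (refl c)
  then show ?case by simp
next
  case (step c n c')
  have pos: "0 < num_tapes M" using assms(1) by (simp add: tm_wf_def)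
  let ?tr = "trans M (fst c) (map (\<lambda>t. t 0) (snd c))"
  have "length (snd ?tr) = num_tapes M"
    using assms(1) step unfolding tm_wf_def by auto
  moreover have "tm_step M c = (fst ?tr, map2 act (snd ?tr) (snd c))"
    using step.hyps by (simp add: tm_step_eq case_prod_beta)
  ultimately have "hd (snd (tm_step M c)) = act (hd (snd ?tr)) (hd (snd c))"
    using step.prems(1) pos by (cases "snd c"; cases "snd ?tr") auto
  then have "finite {i. hd (snd (tm_step M c)) i \<noteq> None}"
    "card {i. hd (snd (tm_step M c)) i \<noteq> None} \<le> Suc (card {i. hd (snd c) i \<noteq> None})"
    using card_nonblank_act[OF step.prems(2)] by auto
  then show ?case using step.IH length_tm_step[OF assms(1) step.prems(1)] by fastforce
qed

lemma nonblank_tape_of: "{i. tape_of w i \<noteq> None} = int ` {..<length w}"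
proof -
  have "i \<in> int ` {..<length w}" if "0 \<le> i" "i < int (length w)" for i
    using that by (intro image_eqI[of _ _ "nat i"]) auto
  then show ?thesis by (auto simp: tape_of_def split: if_splits)
qed

lemma card_nonblank_tape_of: "finite {i. tape_of w i \<noteq> None}" "card {i. tape_of w i \<noteq> None} = length w"
  unfolding nonblank_tape_of by (simp_all add: card_image)

text \<open>Each step makes at most one further cell of tape 0 non-blank. This allows the time of a
  second machine to be measured in the length of the original input.\<close>

lemma length_output_le:
  assumes "tm_wf M" "tm_run M (tm_start M w) n (q, tape_of v # ts)"
  shows "length v \<le> length w + n"
proof -
  have "length (snd (tm_start M w)) = num_tapes M"
    using assms(1) by (simp add: tm_start_def tm_wf_def)
  then show ?thesis
    using card_nonblank_run[OF assms] by (simp add: tm_start_def card_nonblank_tape_of del: not_None_eq)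
qed

section \<open>Cubing a symmetric Boolean matrix\<close>

text \<open>Contents in absolute coordinates plus a head position: a move then changes only
  \<open>p\<close>, although tapes proper are indexed relative to the head.\<close>

definition head_at :: "tape \<Rightarrow> int \<Rightarrow> tape" where
  "head_at s p = (\<lambda>i. s (i + p))"

fun displacement :: "move \<Rightarrow> int" where
  "displacement Go_Left = -1"
| "displacement Stay = 0"
| "displacement Go_Right = 1"

lemma head_at_0 [simp]: "head_at s p 0 = s p"
  by (simp add: head_at_def)

lemma head_at_zero: "head_at s 0 = s"
  by (simp add: head_at_def)

lemma act_head_at [simp]: "act (a, m) (head_at s p) = head_at (s(p := a)) (p + displacement m)"
  by (cases m) (auto simp: act_def head_at_def fun_eq_iff algebra_simps)

abbreviation "tm_move ds \<equiv> tm_prim 5 (\<lambda>ss. zip ss ds)"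

lemma halts_within_prim5:
  assumes "r0 = s0(p0 := b0 [s0 p0, s1 p1, s2 p2, s3 p3, s4 p4])" "q0 = p0 + displacement d0"
    and "r1 = s1(p1 := b1 [s0 p0, s1 p1, s2 p2, s3 p3, s4 p4])" "q1 = p1 + displacement d1"
    and "r2 = s2(p2 := b2 [s0 p0, s1 p1, s2 p2, s3 p3, s4 p4])" "q2 = p2 + displacement d2"
    and "r3 = s3(p3 := b3 [s0 p0, s1 p1, s2 p2, s3 p3, s4 p4])" "q3 = p3 + displacement d3"
    and "r4 = s4(p4 := b4 [s0 p0, s1 p1, s2 p2, s3 p3, s4 p4])" "q4 = p4 + displacement d4"
  shows "halts_within (tm_prim 5 (\<lambda>ss. [(b0 ss, d0), (b1 ss, d1), (b2 ss, d2), (b3 ss, d3), (b4 ss, d4)]))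
     [head_at s0 p0, head_at s1 p1, head_at s2 p2, head_at s3 p3, head_at s4 p4]
     [head_at r0 q0, head_at r1 q1, head_at r2 q2, head_at r3 q3, head_at r4 q4] 1"
  using halts_within_prim[of 5 "\<lambda>ss. [(b0 ss, d0), (b1 ss, d1), (b2 ss, d2), (b3 ss, d3), (b4 ss, d4)]"
     "[head_at s0 p0, head_at s1 p1, head_at s2 p2, head_at s3 p3, head_at s4 p4]"]
  unfolding assms by (simp del: fun_upd_apply)

lemma halts_within_move:
  assumes "q0 = p0 + displacement d0" "q1 = p1 + displacement d1" "q2 = p2 + displacement d2"
    "q3 = p3 + displacement d3" "q4 = p4 + displacement d4"
  shows "halts_within (tm_move [d0, d1, d2, d3, d4])
     [head_at s0 p0, head_at s1 p1, head_at s2 p2, head_at s3 p3, head_at s4 p4]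
     [head_at s0 q0, head_at s1 q1, head_at s2 q2, head_at s3 q3, head_at s4 q4] 1"
  using halts_within_prim[of 5 "\<lambda>ss. zip ss [d0, d1, d2, d3, d4]"
     "[head_at s0 p0, head_at s1 p1, head_at s2 p2, head_at s3 p3, head_at s4 p4]"]
  unfolding assms by simp

text \<open>When the body only moves heads, positions are affine in the round number, and only the
  tests along the way remain to be checked.\<close>

lemma halts_within_while_move:
  assumes "\<And>i. i < m \<Longrightarrow> c [s0 (p0 + int i * displacement d0), s1 (p1 + int i * displacement d1),
        s2 (p2 + int i * displacement d2), s3 (p3 + int i * displacement d3), s4 (p4 + int i * displacement d4)]"
    and "\<not> c [s0 q0, s1 q1, s2 q2, s3 q3, s4 q4]"
    and "q0 = p0 + int m * displacement d0" "q1 = p1 + int m * displacement d1"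
      "q2 = p2 + int m * displacement d2" "q3 = p3 + int m * displacement d3" "q4 = p4 + int m * displacement d4"
  shows "halts_within (tm_while c (tm_move [d0, d1, d2, d3, d4]))
     [head_at s0 p0, head_at s1 p1, head_at s2 p2, head_at s3 p3, head_at s4 p4]
     [head_at s0 q0, head_at s1 q1, head_at s2 q2, head_at s3 q3, head_at s4 q4] (2 * m + 1)"
proof -
  let ?S = "\<lambda>i. [head_at s0 (p0 + int i * displacement d0), head_at s1 (p1 + int i * displacement d1),
        head_at s2 (p2 + int i * displacement d2), head_at s3 (p3 + int i * displacement d3),
        head_at s4 (p4 + int i * displacement d4)]"
  have "halts_within (tm_while c (tm_move [d0, d1, d2, d3, d4])) (?S 0) (?S m) (m * (1 + 1) + 1)"
  proof (rule halts_within_while)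
    show "halts_within (tm_move [d0, d1, d2, d3, d4]) (?S i) (?S (Suc i)) 1" for i
      by (rule halts_within_move) (simp_all add: algebra_simps)
  qed (use assms in simp_all)
  then show ?thesis using assms(3-) by (simp add: mult_2_right mult_2)
qed

abbreviation "marked i \<equiv> (\<lambda>ss. ss ! i = Some True)"
abbreviation "nonblank i \<equiv> (\<lambda>ss. ss ! i \<noteq> None)"

text \<open>
  Five tapes are used: tape 0 holds the input and is overwritten in place by the output, tape 1 holds \<open>n\<close> in unary
  and serves as a loop counter, and tapes 2, 3 and 4 hold copies of the adjacency matrix \<open>A\<close>. The entry \<open>(u, v)\<close>
  of the cube is the disjunction over \<open>a, b\<close> of \<open>A u a \<and> A a b \<and> A v b\<close>; since \<open>A\<close> is symmetric, all three
  matrix heads then move along rows only.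
\<close>

definition scan_row :: tm where
  "scan_row = tm_while (marked 1) (tm_prim 5 (\<lambda>ss.
     [(if ss ! 2 = Some True \<and> ss ! 3 = Some True \<and> ss ! 4 = Some True then Some True else ss ! 0, Stay),
      (ss ! 1, Go_Right), (ss ! 2, Stay), (ss ! 3, Go_Right), (ss ! 4, Go_Right)]))"

text \<open>After each row, the counter and head 4 are wound back together by \<open>n\<close>
  cells, head 2 passes to the next \<open>a\<close>, and head 3 already stands on the next row. The
  loop ends when head 3 leaves the matrix.\<close>

definition scan_matrix :: tm where
  "scan_matrix = tm_while (nonblank 3)
     (scan_row ;;
      tm_move [Stay, Go_Left, Go_Right, Stay, Stay] ;;
      tm_while (marked 1) (tm_move [Stay, Go_Left, Stay, Stay, Go_Left]) ;;
      tm_move [Stay, Go_Right, Stay, Stay, Stay])"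

text \<open>The counter also serves to shift heads by one row: head 2 returns to the start of row
  \<open>u\<close> while head 4 advances to row \<open>v + 1\<close>.\<close>

definition compute_entry :: tm where
  "compute_entry =
     tm_prim 5 (\<lambda>ss. [(Some False, Stay), (ss ! 1, Stay), (ss ! 2, Stay), (ss ! 3, Stay), (ss ! 4, Stay)]) ;;
     scan_matrix ;;
     tm_while (marked 1) (tm_move [Stay, Go_Right, Go_Left, Stay, Go_Right]) ;;
     tm_move [Go_Right, Go_Left, Stay, Go_Left, Stay] ;;
     tm_while (marked 1) (tm_move [Stay, Go_Left, Stay, Stay, Stay]) ;;
     tm_while (nonblank 3) (tm_move [Stay, Stay, Stay, Go_Left, Stay]) ;;
     tm_move [Stay, Go_Right, Stay, Go_Right, Stay]"

definition compute_row :: tm where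
  "compute_row =
     tm_while (nonblank 4) compute_entry ;;
     tm_while (marked 1) (tm_move [Stay, Go_Right, Go_Right, Stay, Stay]) ;;
     tm_move [Stay, Go_Left, Stay, Stay, Go_Left] ;;
     tm_while (marked 1) (tm_move [Stay, Go_Left, Stay, Stay, Stay]) ;;
     tm_while (nonblank 4) (tm_move [Stay, Stay, Stay, Stay, Go_Left]) ;;
     tm_move [Stay, Go_Right, Stay, Stay, Go_Right]"

text \<open>The last rewinding loop tests tape 2, since tape 0 has no blank in front of its matrix:
  head 0 retreats in step with head 2 and stops on the separator.\<close>

definition load_matrix :: tm where
  "load_matrix =
     tm_while (marked 0) (tm_prim 5 (\<lambda>ss. [(ss ! 0, Go_Right), (Some True, Go_Right),
       (ss ! 2, Stay), (ss ! 3, Stay), (ss ! 4, Stay)])) ;;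
     tm_move [Go_Right, Go_Left, Stay, Stay, Stay] ;;
     tm_while (marked 1) (tm_move [Stay, Go_Left, Stay, Stay, Stay]) ;;
     tm_move [Stay, Go_Right, Stay, Stay, Stay] ;;
     tm_while (nonblank 0) (tm_prim 5 (\<lambda>ss. [(ss ! 0, Go_Right), (ss ! 1, Stay),
       (ss ! 0, Go_Right), (ss ! 0, Go_Right), (ss ! 0, Go_Right)])) ;;
     tm_move [Go_Left, Stay, Go_Left, Go_Left, Go_Left] ;;
     tm_while (nonblank 2) (tm_move [Go_Left, Stay, Go_Left, Go_Left, Go_Left]) ;;
     tm_move [Go_Right, Stay, Go_Right, Go_Right, Go_Right]"

definition cube_tm :: tm where
  "cube_tm =
     load_matrix ;;
     tm_while (nonblank 2) compute_row ;;
     tm_move [Go_Left, Stay, Stay, Stay, Stay] ;;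
     tm_while (nonblank 0) (tm_move [Go_Left, Stay, Stay, Stay, Stay]) ;;
     tm_move [Go_Right, Stay, Stay, Stay, Stay]"

lemma tm_wf_cube_tm: "tm_wf cube_tm"
  unfolding cube_tm_def load_matrix_def compute_row_def compute_entry_def scan_matrix_def scan_row_def
  by (intro tm_wf_seq tm_wf_while tm_wf_prim) simp_all

lemma num_tapes_cube_tm: "num_tapes cube_tm = 5"
  by (simp add: cube_tm_def load_matrix_def)

section \<open>Correctness and running time of the cubing machine\<close>

locale symmetric_matrix =
  fixes n :: nat and E :: "(nat \<times> nat) set"
  assumes sym_E: "sym E" and E_sub: "E \<subseteq> {..<n} \<times> {..<n}"
begin

definition entry :: "nat \<Rightarrow> bool" where
  "entry j \<longleftrightarrow> (j div n, j mod n) \<in> E"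

definition cube_entry :: "nat \<Rightarrow> bool" where
  "cube_entry j \<longleftrightarrow> (j div n, j mod n) \<in> E O E O E"

definition matrix_tape :: tape where
  "matrix_tape i = (if 0 \<le> i \<and> i < int (n * n) then Some (entry (nat i)) else None)"

definition unary_tape :: "nat \<Rightarrow> tape" where
  "unary_tape m i = (if 0 \<le> i \<and> i < int m then Some True else None)"

text \<open>Tape 0 when the first \<open>m\<close> matrix entries have been replaced by those of the cube.\<close>

definition io_tape :: "nat \<Rightarrow> tape" where
  "io_tape m i = (if 0 \<le> i \<and> i < int n then Some True
     else if i = int n then Some False
     else if int n < i \<and> i < int (n + 1 + m) then Some (cube_entry (nat (i - int n - 1)))
     else matrix_tape (i - int n - 1))"

text \<open>The value of entry \<open>(u, v)\<close> of the cube after the first \<open>j\<close> pairs \<open>(a, b)\<close>, numbered \<open>a n + b\<close>.\<close>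

definition found :: "nat \<Rightarrow> nat \<Rightarrow> nat \<Rightarrow> bool" where
  "found u v j \<longleftrightarrow> (\<exists>i<j. entry (u * n + i div n) \<and> entry i \<and> entry (v * n + i mod n))"

lemma matrix_tape_int: "j < n * n \<Longrightarrow> matrix_tape (int j) = Some (entry j)"
  by (simp add: matrix_tape_def del: of_nat_mult)

lemma index_less: "u < n \<Longrightarrow> v < n \<Longrightarrow> u * n + v < n * n"
  using mult_le_mono1[of "Suc u" n n] by simp

lemma found_Suc:
  assumes "b < n"
  shows "found u v (a * n + Suc b) \<longleftrightarrow>
    found u v (a * n + b) \<or> entry (u * n + a) \<and> entry (a * n + b) \<and> entry (v * n + b)"
  using assms by (auto simp: found_def less_Suc_eq)

lemma unary_tape_simps [simp]:
  "0 \<le> i \<Longrightarrow> i < int m \<Longrightarrow> unary_tape m i = Some True" "i < 0 \<Longrightarrow> unary_tape m i = None"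
  "int m \<le> i \<Longrightarrow> unary_tape m i = None"
  by (simp_all add: unary_tape_def)

text \<open>Once loaded, tapes 1 to 4 are only read, so tape 0 and the five head positions describe
  everything.\<close>

abbreviation "tapes t p c i j k \<equiv>
  [head_at t p, head_at (unary_tape n) c, head_at matrix_tape i, head_at matrix_tape j, head_at matrix_tape k]"

text \<open>Only the cell under head 0 is written, hence the form \<open>t(p := ...)\<close> with
  arbitrary \<open>t\<close>; that cell accumulates the disjunction over \<open>b\<close>.\<close>

lemma scan_row:
  assumes "u < n" "v < n" "a < n"
  shows "halts_within scan_row
    (tapes (t(p := Some (found u v (a * n)))) p 0 (int (u * n + a)) (int (a * n)) (int (v * n)))
    (tapes (t(p := Some (found u v (Suc a * n)))) p (int n) (int (u * n + a)) (int (Suc a * n)) (int (v * n + n)))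
    (2 * n + 1)"
proof -
  let ?S = "\<lambda>b. tapes (t(p := Some (found u v (a * n + b)))) p (int b)
     (int (u * n + a)) (int (a * n + b)) (int (v * n + b))"
  have "halts_within scan_row (?S 0) (?S n) (n * (1 + 1) + 1)"
    unfolding scan_row_def
  proof (rule halts_within_while)
    fix b assume b: "b < n"
    show "marked 1 (map (\<lambda>t. t 0) (?S b))" using b by simp
    have *: "matrix_tape (int (u * n + a)) = Some (entry (u * n + a))"
      "matrix_tape (int (a * n + b)) = Some (entry (a * n + b))"
      "matrix_tape (int (v * n + b)) = Some (entry (v * n + b))"
      using index_less assms b by (simp_all add: matrix_tape_int del: of_nat_add of_nat_mult)
    show "halts_within (tm_prim 5 (\<lambda>ss.
     [(if ss ! 2 = Some True \<and> ss ! 3 = Some True \<and> ss ! 4 = Some True then Some True else ss ! 0, Stay),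
      (ss ! 1, Go_Right), (ss ! 2, Stay), (ss ! 3, Go_Right), (ss ! 4, Go_Right)])) (?S b) (?S (Suc b)) 1"
    proof (rule halts_within_prim5, goal_cases)
      case 1
      show ?case using * by (auto simp: found_Suc[OF b] simp del: add_Suc_right of_nat_add of_nat_mult)
    qed simp_all
  qed simp
  then show ?thesis by (simp add: mult_2 mult_2_right add.commute)
qed

text \<open>The indices below \<open>n * n\<close> are the pairs \<open>(a, b)\<close> in row-major
  order, and symmetry turns \<open>(v, b)\<close> into the last arc \<open>(b, v)\<close> of a
  walk.\<close>

lemma found_all:
  assumes "v < n"
  shows "found u v (n * n) = cube_entry (u * n + v)"
proof -
  have "found u v (n * n) \<longleftrightarrow> (\<exists>a<n. \<exists>b<n. (u, a) \<in> E \<and> (a, b) \<in> E \<and> (v, b) \<in> E)"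
  proof
    assume "found u v (n * n)"
    then obtain i where i: "i < n * n" "entry (u * n + i div n)" "entry i" "entry (v * n + i mod n)"
      unfolding found_def by blast
    then have "i div n < n" "i mod n < n" using assms by (auto simp: less_mult_imp_div_less) 
    then show "\<exists>a<n. \<exists>b<n. (u, a) \<in> E \<and> (a, b) \<in> E \<and> (v, b) \<in> E"
      using i(2-4) assms by (intro exI[of _ "i div n"] conjI exI[of _ "i mod n"]) (auto simp: entry_def)
  next
    assume "\<exists>a<n. \<exists>b<n. (u, a) \<in> E \<and> (a, b) \<in> E \<and> (v, b) \<in> E"
    then obtain a b where "a < n" "b < n" "(u, a) \<in> E" "(a, b) \<in> E" "(v, b) \<in> E" by blast
    then show "found u v (n * n)"
      unfolding found_def by (intro exI[of _ "a * n + b"]) (auto simp: entry_def index_less)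
  qed
  also have "\<dots> \<longleftrightarrow> (u, v) \<in> E O E O E"
  proof
    assume "(u, v) \<in> E O E O E"
    then obtain a b where "(u, a) \<in> E" "(a, b) \<in> E" "(b, v) \<in> E" by blast
    moreover from this have "a < n" "b < n" using E_sub by auto
    ultimately show "\<exists>a<n. \<exists>b<n. (u, a) \<in> E \<and> (a, b) \<in> E \<and> (v, b) \<in> E"
      using symD[OF sym_E] by blast
  qed (use symD[OF sym_E] in blast)
  finally show ?thesis using assms by (simp add: cube_entry_def)
qed

lemma scan_matrix:
  assumes "u < n" "v < n"
  shows "halts_within scan_matrix
    (tapes (t(p := Some False)) p 0 (int (u * n)) 0 (int (v * n)))
    (tapes (t(p := Some (cube_entry (u * n + v)))) p 0 (int (u * n + n)) (int (n * n)) (int (v * n)))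
    (n * (4 * n + 5) + 1)"
proof -
  let ?S = "\<lambda>a. tapes (t(p := Some (found u v (a * n)))) p 0 (int (u * n + a)) (int (a * n)) (int (v * n))"
  have "halts_within scan_matrix (?S 0) (?S n) (n * (2 * n + 1 + 1 + (2 * n + 1) + 1 + 1) + 1)"
    unfolding scan_matrix_def
  proof (rule halts_within_while, goal_cases)
    case (1 a)
    then show ?case using index_less[of a 0] by (simp add: matrix_tape_int del: of_nat_mult)
  next
    case 2
    show ?case by (simp add: matrix_tape_def)
  next
    case (3 a)
    let ?t = "t(p := Some (found u v (Suc a * n)))"
    note scan_row[OF assms 3]
    also have "halts_within (tm_move [Stay, Go_Left, Go_Right, Stay, Stay])
        (tapes ?t p (int n) (int (u * n + a)) (int (Suc a * n)) (int (v * n + n)))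
        (tapes ?t p (int n - 1) (int (u * n + Suc a)) (int (Suc a * n)) (int (v * n + n))) 1"
      by (rule halts_within_move) simp_all
    also have "halts_within (tm_while (marked 1) (tm_move [Stay, Go_Left, Stay, Stay, Go_Left]))
        (tapes ?t p (int n - 1) (int (u * n + Suc a)) (int (Suc a * n)) (int (v * n + n)))
        (tapes ?t p (-1) (int (u * n + Suc a)) (int (Suc a * n)) (int (v * n))) (2 * n + 1)"
      by (rule halts_within_while_move) simp_all
    also have "halts_within (tm_move [Stay, Go_Right, Stay, Stay, Stay])
        (tapes ?t p (-1) (int (u * n + Suc a)) (int (Suc a * n)) (int (v * n))) (?S (Suc a)) 1"
      by (rule halts_within_move) simp_all
    finally show ?case .
  qed
  \<comment> \<open>The empty disjunction agrees with the initial content of the cell.\<close>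
  moreover have "found u v 0 = False" by (simp add: found_def)
  ultimately show ?thesis using found_all[OF assms(2)] by (simp add: algebra_simps)
qed

text \<open>Overwriting in place is harmless, as later entries are computed from the copies on tapes
  2 to 4.\<close>

lemma io_tape_Suc: "(io_tape m)(int (n + 1 + m) := Some (cube_entry m)) = io_tape (Suc m)"
  by (auto simp: io_tape_def fun_eq_iff)

lemma compute_entry:
  assumes "u < n" "v < n"
  shows "halts_within compute_entry
    (tapes (io_tape (u * n + v)) (int (n + 1 + (u * n + v))) 0 (int (u * n)) 0 (int (v * n)))
    (tapes (io_tape (u * n + Suc v)) (int (n + 1 + (u * n + Suc v))) 0 (int (u * n)) 0 (int (Suc v * n)))
    (6 * n * n + 9 * n + 7)"
proof -
  let ?t = "io_tape (u * n + v)" and ?t' = "io_tape (u * n + Suc v)" and ?p = "int (n + 1 + (u * n + v))"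
  have t': "?t(?p := Some (cube_entry (u * n + v))) = ?t'"
    using io_tape_Suc[of "u * n + v"] by simp
  have "halts_within
      (tm_prim 5 (\<lambda>ss. [(Some False, Stay), (ss ! 1, Stay), (ss ! 2, Stay), (ss ! 3, Stay), (ss ! 4, Stay)]))
      (tapes ?t ?p 0 (int (u * n)) 0 (int (v * n)))
      (tapes (?t(?p := Some False)) ?p 0 (int (u * n)) 0 (int (v * n))) 1"
    by (rule halts_within_prim5) simp_all
  also note scan_matrix[OF assms, of ?t ?p, unfolded t']
  also have "halts_within (tm_while (marked 1) (tm_move [Stay, Go_Right, Go_Left, Stay, Go_Right]))
      (tapes ?t' ?p 0 (int (u * n + n)) (int (n * n)) (int (v * n)))
      (tapes ?t' ?p (int n) (int (u * n)) (int (n * n)) (int (Suc v * n))) (2 * n + 1)"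
    by (rule halts_within_while_move) simp_all
  also have "halts_within (tm_move [Go_Right, Go_Left, Stay, Go_Left, Stay])
      (tapes ?t' ?p (int n) (int (u * n)) (int (n * n)) (int (Suc v * n)))
      (tapes ?t' (?p + 1) (int n - 1) (int (u * n)) (int (n * n) - 1) (int (Suc v * n))) 1"
    by (rule halts_within_move) simp_all
  also have "halts_within (tm_while (marked 1) (tm_move [Stay, Go_Left, Stay, Stay, Stay]))
      (tapes ?t' (?p + 1) (int n - 1) (int (u * n)) (int (n * n) - 1) (int (Suc v * n)))
      (tapes ?t' (?p + 1) (-1) (int (u * n)) (int (n * n) - 1) (int (Suc v * n))) (2 * n + 1)"
    by (rule halts_within_while_move) simp_all
  also have "halts_within (tm_while (nonblank 3) (tm_move [Stay, Stay, Stay, Go_Left, Stay]))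
      (tapes ?t' (?p + 1) (-1) (int (u * n)) (int (n * n) - 1) (int (Suc v * n)))
      (tapes ?t' (?p + 1) (-1) (int (u * n)) (-1) (int (Suc v * n))) (2 * (n * n) + 1)"
    by (rule halts_within_while_move) (simp_all add: matrix_tape_def flip: of_nat_mult)
  also have "halts_within (tm_move [Stay, Go_Right, Stay, Go_Right, Stay])
      (tapes ?t' (?p + 1) (-1) (int (u * n)) (-1) (int (Suc v * n)))
      (tapes ?t' (int (n + 1 + (u * n + Suc v))) 0 (int (u * n)) 0 (int (Suc v * n))) 1"
    by (rule halts_within_move) simp_all
  finally show ?thesis
    unfolding compute_entry_def by (rule halts_within_mono) (simp add: algebra_simps)
qed

lemma compute_row:
  assumes "u < n"
  shows "halts_within compute_row
    (tapes (io_tape (u * n)) (int (n + 1 + u * n)) 0 (int (u * n)) 0 0)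
    (tapes (io_tape (Suc u * n)) (int (n + 1 + Suc u * n)) 0 (int (Suc u * n)) 0 0)
    (n * (6 * n * n + 9 * n + 8) + 2 * n * n + 4 * n + 6)"
proof -
  let ?S = "\<lambda>v. tapes (io_tape (u * n + v)) (int (n + 1 + (u * n + v))) 0 (int (u * n)) 0 (int (v * n))"
  have "halts_within (tm_while (nonblank 4) compute_entry) (?S 0) (?S n) (n * (6 * n * n + 9 * n + 7 + 1) + 1)"
  proof (rule halts_within_while, goal_cases)
    case (1 v)
    then show ?case using index_less[of v 0] by (simp add: matrix_tape_int del: of_nat_mult)
  next
    case 2
    show ?case by (simp add: matrix_tape_def)
  next
    case (3 v)
    show ?case by (rule compute_entry[OF assms 3])
  qed
  also have "halts_within (tm_while (marked 1) (tm_move [Stay, Go_Right, Go_Right, Stay, Stay]))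
      (?S n) (tapes (io_tape (u * n + n)) (int (n + 1 + (u * n + n))) (int n) (int (Suc u * n)) 0 (int (n * n))) (2 * n + 1)"
    by (rule halts_within_while_move) simp_all
  also have "halts_within (tm_move [Stay, Go_Left, Stay, Stay, Go_Left])
      (tapes (io_tape (u * n + n)) (int (n + 1 + (u * n + n))) (int n) (int (Suc u * n)) 0 (int (n * n)))
      (tapes (io_tape (u * n + n)) (int (n + 1 + (u * n + n))) (int n - 1) (int (Suc u * n)) 0 (int (n * n) - 1)) 1"
    by (rule halts_within_move) simp_all
  also have "halts_within (tm_while (marked 1) (tm_move [Stay, Go_Left, Stay, Stay, Stay]))
      (tapes (io_tape (u * n + n)) (int (n + 1 + (u * n + n))) (int n - 1) (int (Suc u * n)) 0 (int (n * n) - 1))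
      (tapes (io_tape (u * n + n)) (int (n + 1 + (u * n + n))) (-1) (int (Suc u * n)) 0 (int (n * n) - 1)) (2 * n + 1)"
    by (rule halts_within_while_move) simp_all
  also have "halts_within (tm_while (nonblank 4) (tm_move [Stay, Stay, Stay, Stay, Go_Left]))
      (tapes (io_tape (u * n + n)) (int (n + 1 + (u * n + n))) (-1) (int (Suc u * n)) 0 (int (n * n) - 1))
      (tapes (io_tape (u * n + n)) (int (n + 1 + (u * n + n))) (-1) (int (Suc u * n)) 0 (-1)) (2 * (n * n) + 1)"
    by (rule halts_within_while_move) (simp_all add: matrix_tape_def flip: of_nat_mult)
  also have "halts_within (tm_move [Stay, Go_Right, Stay, Stay, Go_Right])
      (tapes (io_tape (u * n + n)) (int (n + 1 + (u * n + n))) (-1) (int (Suc u * n)) 0 (-1))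
      (tapes (io_tape (u * n + n)) (int (n + 1 + (u * n + n))) 0 (int (Suc u * n)) 0 0) 1"
    by (rule halts_within_move) simp_all
  finally show ?thesis
    unfolding compute_row_def by (auto simp: algebra_simps elim!: halts_within_mono)
qed

definition matrix_prefix :: "nat \<Rightarrow> tape" where
  "matrix_prefix m i = (if i < int m then matrix_tape i else None)"

lemma matrix_prefix_Suc: "(matrix_prefix m)(int m := matrix_tape (int m)) = matrix_prefix (Suc m)"
  by (auto simp: matrix_prefix_def fun_eq_iff)

lemma matrix_prefix_0: "matrix_prefix 0 = (\<lambda>_. None)" and matrix_prefix_all: "matrix_prefix (n * n) = matrix_tape"
  by (auto simp: matrix_prefix_def matrix_tape_def fun_eq_iff)

lemma unary_tape_Suc: "(unary_tape m)(int m := Some True) = unary_tape (Suc m)"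
  by (auto simp: unary_tape_def fun_eq_iff)

lemma unary_tape_0: "unary_tape 0 = (\<lambda>_. None)"
  by (auto simp: unary_tape_def fun_eq_iff)

lemma io_tape_eq_None_iff: "m \<le> n * n \<Longrightarrow> io_tape m i = None \<longleftrightarrow> i < 0 \<or> int (n + 1 + n * n) \<le> i"
  by (auto simp: io_tape_def matrix_tape_def simp del: of_nat_mult)

lemma load_matrix:
  "halts_within load_matrix (io_tape 0 # replicate 4 (\<lambda>_. None))
     (tapes (io_tape 0) (int (n + 1)) 0 0 0 0) (4 * (n * n) + 4 * n + 8)"
proof -
  let ?t = "io_tape 0"
  let ?T = "\<lambda>p m c k i. [head_at ?t p, head_at (unary_tape m) c,
    head_at (matrix_prefix k) i, head_at (matrix_prefix k) i, head_at (matrix_prefix k) i]"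
  have "halts_within (tm_while (marked 0) (tm_prim 5 (\<lambda>ss. [(ss ! 0, Go_Right), (Some True, Go_Right),
       (ss ! 2, Stay), (ss ! 3, Stay), (ss ! 4, Stay)])))
      (?T (int 0) 0 (int 0) 0 0) (?T (int n) n (int n) 0 0) (n * (1 + 1) + 1)"
  proof (rule halts_within_while[where S = "\<lambda>m. ?T (int m) m (int m) 0 0"], goal_cases)
    case (1 m)
    then show ?case by (simp add: io_tape_def)
  next
    case 2
    show ?case by (simp add: io_tape_def)
  next
    case (3 m)
    show ?case by (rule halts_within_prim5) (simp_all add: unary_tape_Suc)
  qed
  also have "halts_within (tm_move [Go_Right, Go_Left, Stay, Stay, Stay])
      (?T (int n) n (int n) 0 0) (?T (int (n + 1)) n (int n - 1) 0 0) 1"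
    by (rule halts_within_move) simp_all
  also have "halts_within (tm_while (marked 1) (tm_move [Stay, Go_Left, Stay, Stay, Stay]))
      (?T (int (n + 1)) n (int n - 1) 0 0) (?T (int (n + 1)) n (-1) 0 0) (2 * n + 1)"
    by (rule halts_within_while_move) simp_all
  also have "halts_within (tm_move [Stay, Go_Right, Stay, Stay, Stay])
      (?T (int (n + 1)) n (-1) 0 0) (?T (int (n + 1)) n 0 0 0) 1"
    by (rule halts_within_move) simp_all
  also have "halts_within (tm_while (nonblank 0) (tm_prim 5 (\<lambda>ss. [(ss ! 0, Go_Right), (ss ! 1, Stay),
       (ss ! 0, Go_Right), (ss ! 0, Go_Right), (ss ! 0, Go_Right)])))
      (?T (int (n + 1)) n 0 0 0) (?T (int (n + 1 + n * n)) n 0 (n * n) (int (n * n))) (n * n * (1 + 1) + 1)"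
  proof -
    let ?S = "\<lambda>k. ?T (int (n + 1 + k)) n 0 k (int k)"
    have "halts_within (tm_while (nonblank 0) (tm_prim 5 (\<lambda>ss. [(ss ! 0, Go_Right), (ss ! 1, Stay),
       (ss ! 0, Go_Right), (ss ! 0, Go_Right), (ss ! 0, Go_Right)])))
      (?S 0) (?S (n * n)) (n * n * (1 + 1) + 1)"
    proof (rule halts_within_while, goal_cases)
      case (1 k)
      then show ?case by (simp add: io_tape_eq_None_iff flip: of_nat_mult)
    next
      case 2
      show ?case by (simp add: io_tape_eq_None_iff)
    next
      case (3 k)
      have "io_tape 0 (int (n + 1 + k)) = matrix_tape (int k)" by (simp add: io_tape_def)
      \<comment> \<open>Tape 0 writes back the symbol it scans; this trivial update gives it the
        form that \<open>halts_within_prim5\<close> expects.\<close>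
      moreover from this have "io_tape 0 = (io_tape 0)(int (n + 1 + k) := matrix_tape (int k))"
        by (metis fun_upd_triv)
      ultimately show ?case
        by (intro halts_within_prim5) (simp_all add: matrix_prefix_Suc del: of_nat_add fun_upd_apply)
    qed
    then show ?thesis by simp
  qed
  also have "halts_within (tm_move [Go_Left, Stay, Go_Left, Go_Left, Go_Left])
      (?T (int (n + 1 + n * n)) n 0 (n * n) (int (n * n))) 
      (?T (int (n + n * n)) n 0 (n * n) (int (n * n) - 1)) 1"
    by (rule halts_within_move) simp_all
  also have "halts_within (tm_while (nonblank 2) (tm_move [Go_Left, Stay, Go_Left, Go_Left, Go_Left]))
      (?T (int (n + n * n)) n 0 (n * n) (int (n * n) - 1)) (?T (int n) n 0 (n * n) (-1)) (2 * (n * n) + 1)"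
    unfolding matrix_prefix_all
    by (rule halts_within_while_move) (simp_all add: matrix_tape_def flip: of_nat_mult)
  also have "halts_within (tm_move [Go_Right, Stay, Go_Right, Go_Right, Go_Right])
      (?T (int n) n 0 (n * n) (-1)) (?T (int (n + 1)) n 0 (n * n) 0) 1"
    by (rule halts_within_move) simp_all
  finally have "halts_within load_matrix (?T (int 0) 0 (int 0) 0 0) (?T (int (n + 1)) n 0 (n * n) 0)
      (4 * (n * n) + 4 * n + 8)"
    unfolding load_matrix_def by (rule halts_within_mono) (simp add: algebra_simps)
  moreover have "io_tape 0 # replicate 4 (\<lambda>_. None) = ?T (int 0) 0 (int 0) 0 0"
    by (simp add: head_at_zero unary_tape_0 matrix_prefix_0 numeral_eq_Suc)
  ultimately show ?thesis by (simp only: matrix_prefix_all)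
qed

text \<open>Each of \<open>n * n\<close> entries scans \<open>n * n\<close> pairs, hence the degree
  4; the constant is generous.\<close>

lemma cube_tm:
  "\<exists>ts. halts_within cube_tm (io_tape 0 # replicate 4 (\<lambda>_. None)) (io_tape (n * n) # ts) (1000 * (n + 1) ^ 4)"
proof -
  let ?b = "n * (6 * n * n + 9 * n + 8) + 2 * n * n + 4 * n + 6"
  let ?S = "\<lambda>u. tapes (io_tape (u * n)) (int (n + 1 + u * n)) 0 (int (u * n)) 0 0"
  let ?t = "io_tape (n * n)"
  note load_matrix
  also have "halts_within (tm_while (nonblank 2) compute_row) (tapes (io_tape 0) (int (n + 1)) 0 0 0 0) (?S n) (n * (?b + 1) + 1)"
  proof -
    have "halts_within (tm_while (nonblank 2) compute_row) (?S 0) (?S n) (n * (?b + 1) + 1)"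
    proof (rule halts_within_while, goal_cases)
      case (1 u)
      then show ?case using index_less[of u 0] by (simp add: matrix_tape_int del: of_nat_mult)
    next
      case 2
      show ?case by (simp add: matrix_tape_def)
    next
      case (3 u)
      then show ?case by (rule compute_row)
    qed
    then show ?thesis by simp
  qed
  also have "halts_within (tm_move [Go_Left, Stay, Stay, Stay, Stay]) (?S n)
      (tapes ?t (int (n + n * n)) 0 (int (n * n)) 0 0) 1"
    by (rule halts_within_move) simp_all
  also have "halts_within (tm_while (nonblank 0) (tm_move [Go_Left, Stay, Stay, Stay, Stay]))
      (tapes ?t (int (n + n * n)) 0 (int (n * n)) 0 0)
      (tapes ?t (-1) 0 (int (n * n)) 0 0) (2 * (n + 1 + n * n) + 1)"
    by (rule halts_within_while_move) (simp_all add: io_tape_eq_None_iff flip: of_nat_mult)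
  also have "halts_within (tm_move [Go_Right, Stay, Stay, Stay, Stay])
      (tapes ?t (-1) 0 (int (n * n)) 0 0) (tapes ?t 0 0 (int (n * n)) 0 0) 1"
    by (rule halts_within_move) simp_all
  finally have "halts_within cube_tm (io_tape 0 # replicate 4 (\<lambda>_. None))
      (tapes ?t 0 0 (int (n * n)) 0 0) (1000 * (n + 1) ^ 4)"
    unfolding cube_tm_def
    by (rule halts_within_mono) (simp add: algebra_simps power4_eq_xxxx)
  then show ?thesis unfolding head_at_zero by blast
qed

end

section \<open>Graph codes and the cube of a graph\<close>

lemma length_concat_map_upt: "length (concat (map (\<lambda>u. map (f u) [0..<n]) [0..<m])) = m * n"
  by (induction m) simp_all

lemma nth_concat_map_upt:
  assumes "j < m * n"
  shows "concat (map (\<lambda>u. map (f u) [0..<n]) [0..<m]) ! j = f (j div n) (j mod n)"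
  using assms
proof (induction m)
  case (Suc m)
  note len = length_concat_map_upt
  show ?case
  proof (cases "j < m * n")
    case True
    then show ?thesis using Suc.IH by (simp add: nth_append len)
  next
    case False
    then have "j = m * n + (j - m * n)" "j - m * n < n" using Suc.prems by auto
    moreover from this have "j div n = m" "j mod n = j - m * n"
      by (metis add.right_neutral div_less div_mult_self3 gr_implies_not0,
          metis mod_less mod_mult_self3)
    ultimately show ?thesis using False by (simp add: nth_append len)
  qed
qed simp

text \<open>Closed walks of length 3, as in a triangle, become loops;
  \<open>pair_pseudo_graph\<close> is closed under the operation.\<close>

definition cube_graph :: "'a pair_pre_digraph \<Rightarrow> 'a pair_pre_digraph" where
  "cube_graph G = \<lparr>pverts = pverts G, parcs = parcs G O parcs G O parcs G\<rparr>"

lemma pair_pseudo_graph_iff: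
  "pair_pseudo_graph G \<longleftrightarrow> finite (pverts G) \<and> parcs G \<subseteq> pverts G \<times> pverts G \<and> sym (parcs G)"
proof
  assume "pair_pseudo_graph G"
  then interpret pair_pseudo_graph G .
  show "finite (pverts G) \<and> parcs G \<subseteq> pverts G \<times> pverts G \<and> sym (parcs G)"
    using pair_finite_verts pair_sym_arcs arc_fst_in_verts arc_snd_in_verts
    by (auto simp: symmetric_def dest: arc_fst_in_verts arc_snd_in_verts)
next
  assume *: "finite (pverts G) \<and> parcs G \<subseteq> pverts G \<times> pverts G \<and> sym (parcs G)"
  then show "pair_pseudo_graph G"
    by unfold_locales (auto simp: symmetric_def intro: finite_subset)
qed

lemma pair_pseudo_graph_cube: "pair_pseudo_graph G \<Longrightarrow> pair_pseudo_graph (cube_graph G)"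
  by (auto simp: pair_pseudo_graph_iff cube_graph_def sym_def relcomp_unfold) blast

lemma instance_graph_cube: "instance_graph I \<Longrightarrow> instance_graph (cube_graph I)"
  unfolding instance_graph_def using pair_pseudo_graph_cube by (auto simp: cube_graph_def)

text \<open>The code of a graph on \<open>n\<close> vertices has length
  \<open>n + 1 + n * n\<close>, so a bound in \<open>n\<close> yields one in the input
  length.\<close>

lemma cube_tm_graph_code:
  assumes "instance_graph I"
  shows "\<exists>ts. halts_within cube_tm (tape_of (graph_code I) # replicate 4 (tape_of []))
    (tape_of (graph_code (cube_graph I)) # ts) (1000 * (length (graph_code I) + 1) ^ 4)"
proof -
  from assms obtain n where V: "pverts I = {..<n}" and "pair_pseudo_graph I"
    unfolding instance_graph_def by auto
  then interpret symmetric_matrix n "parcs I"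
    by unfold_locales (auto simp: pair_pseudo_graph_iff)
  have len: "length (graph_code J) = n + 1 + n * n" if "pverts J = {..<n}" for J
    using that by (simp add: graph_code_def length_concat_map_upt)
  have code: "tape_of (graph_code J) i = (if 0 \<le> i \<and> i < int n then Some True
     else if i = int n then Some False
     else if int n < i \<and> i < int (n + 1 + n * n)
       then Some ((nat (i - int n - 1) div n, nat (i - int n - 1) mod n) \<in> parcs J) else None)"
    if J: "pverts J = {..<n}" for J i
  proof -
    have "graph_code J ! nat i = ((nat (i - int n - 1) div n, nat (i - int n - 1) mod n) \<in> parcs J)"
      if "int n < i" "i < int (n + 1 + n * n)"
    proof -
      define j where "j = nat (i - int n - 1)"
      have i: "nat i = Suc (n + j)" "j < n * n" using that by (auto simp: j_def simp flip: of_nat_mult)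
      show ?thesis
        unfolding j_def[symmetric] using J i
        by (simp add: graph_code_def nth_append nth_concat_map_upt)
    qed
    moreover have "graph_code J ! nat i \<longleftrightarrow> i \<noteq> int n" if "0 \<le> i" "i \<le> int n"
    proof -
      from that obtain j where j: "i = int j" "j \<le> n" by (metis nonneg_int_cases of_nat_le_iff)
      then show ?thesis using J by (cases "j = n") (simp_all add: graph_code_def nth_append)
    qed
    moreover have "tape_of (graph_code J) i =
        (if 0 \<le> i \<and> i < int (n + 1 + n * n) then Some (graph_code J ! nat i) else None)"
      by (simp only: tape_of_def len[OF J])
    moreover have "int n < int (n + 1 + n * n)" by linarith
    ultimately show ?thesis by (cases i "int n" rule: linorder_cases) force+
  qed
  have *: "0 \<le> i - int n - 1 \<and> i - int n - 1 < int (n * n) \<longleftrightarrow> int n < i \<and> i < int (n + 1 + n * n)" for i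
    by linarith
  have "tape_of (graph_code I) = io_tape 0"
    by (rule ext) (simp only: code[OF V] io_tape_def matrix_tape_def entry_def *, simp)
  moreover have "tape_of (graph_code (cube_graph I)) = io_tape (n * n)"
  proof (rule ext)
    fix i
    have "pverts (cube_graph I) = {..<n}" using V by (simp add: cube_graph_def)
    from code[OF this] show "tape_of (graph_code (cube_graph I)) i = io_tape (n * n) i"
      by (simp only: io_tape_def matrix_tape_def cube_entry_def *) (simp add: cube_graph_def)
  qed
  moreover have "tape_of [] = (\<lambda>_. None)" by (auto simp: tape_of_def)
  moreover have "1000 * (n + 1) ^ 4 \<le> 1000 * (length (graph_code I) + 1) ^ 4"
    unfolding len[OF V] by (intro mult_left_mono power_mono) auto
  ultimately show ?thesis using cube_tm halts_within_mono by fastforce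
qed

section \<open>Polynomial time bounds\<close>

text \<open>The base \<open>x + 1\<close> is never 0, so exponents can be raised, which gives
  closure under sums; the form used in \<open>poly_time\<close> is equivalent.\<close>

definition poly_bounded :: "(nat \<Rightarrow> nat) \<Rightarrow> bool" where
  "poly_bounded g \<longleftrightarrow> (\<exists>c d. \<forall>x. g x \<le> c * (x + 1) ^ d)"

lemma poly_bounded_iff: "poly_bounded g \<longleftrightarrow> (\<exists>c d. \<forall>x. g x \<le> c * x ^ d + c)"
proof
  assume "poly_bounded g"
  then obtain c d where cd: "\<And>x. g x \<le> c * (x + 1) ^ d" unfolding poly_bounded_def by blast
  have "(x + 1) ^ d \<le> 2 ^ d * x ^ d + 2 ^ d" for x :: nat
  \<comment> \<open>For positive \<open>x\<close>, \<open>x + 1 \<le> 2 * x\<close>; at 0 the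
    constant term is enough.\<close>
  proof (cases "x = 0")
    case False
    then have "(x + 1) ^ d \<le> (2 * x) ^ d" by (intro power_mono) auto
    then show ?thesis by (simp add: power_mult_distrib)
  qed (simp add: trans_le_add2)
  then have "g x \<le> (c * 2 ^ d) * x ^ d + c * 2 ^ d" for x
    using cd[of x] mult_le_mono2[of "(x + 1) ^ d" "2 ^ d * x ^ d + 2 ^ d" c]
    by (simp add: algebra_simps)
  then show "\<exists>c d. \<forall>x. g x \<le> c * x ^ d + c" by blast
next
  assume "\<exists>c d. \<forall>x. g x \<le> c * x ^ d + c"
  then obtain c d where cd: "\<And>x. g x \<le> c * x ^ d + c" by blast
  have "x ^ d + 1 \<le> 2 * (x + 1) ^ d" for x :: nat
    using power_mono[of x "x + 1" d] one_le_power[of "x + 1" d] by linarith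
  then have "g x \<le> (c * 2) * (x + 1) ^ d" for x
    using cd[of x] mult_le_mono2[of "x ^ d + 1" "2 * (x + 1) ^ d" c]
    by (simp add: algebra_simps)
  then show "poly_bounded g" unfolding poly_bounded_def by blast
qed

lemma poly_bounded_const: "poly_bounded (\<lambda>x. k)"
  unfolding poly_bounded_def by (rule exI[of _ k], rule exI[of _ 0]) simp

lemma poly_bounded_id: "poly_bounded (\<lambda>x. x)"
  unfolding poly_bounded_def by (rule exI[of _ 1], rule exI[of _ 1]) simp

lemma poly_bounded_mult:
  assumes "poly_bounded f" "poly_bounded g" shows "poly_bounded (\<lambda>x. f x * g x)"
proof -
  from assms obtain c d c' d' where "\<And>x. f x \<le> c * (x + 1) ^ d" "\<And>x. g x \<le> c' * (x + 1) ^ d'"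
    unfolding poly_bounded_def by blast
  then have "f x * g x \<le> (c * (x + 1) ^ d) * (c' * (x + 1) ^ d')" for x by (intro mult_le_mono)
  then have "f x * g x \<le> (c * c') * (x + 1) ^ (d + d')" for x by (simp add: power_add ac_simps)
  then show ?thesis unfolding poly_bounded_def by blast
qed

lemma poly_bounded_add:
  assumes "poly_bounded f" "poly_bounded g" shows "poly_bounded (\<lambda>x. f x + g x)"
proof -
  from assms obtain c d c' d' where 1: "\<And>x. f x \<le> c * (x + 1) ^ d" "\<And>x. g x \<le> c' * (x + 1) ^ d'"
    unfolding poly_bounded_def by blast
  have "c * (x + 1) ^ d \<le> c * (x + 1) ^ (d + d')" "c' * (x + 1) ^ d' \<le> c' * (x + 1) ^ (d + d')" for x :: nat
    by (intro mult_le_mono2 power_increasing; simp)+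
  then have "f x + g x \<le> (c + c') * (x + 1) ^ (d + d')" for x
    unfolding add_mult_distrib by (intro add_mono order_trans[OF 1(1)] order_trans[OF 1(2)])
  then show ?thesis unfolding poly_bounded_def by blast
qed

lemma poly_bounded_power: "poly_bounded f \<Longrightarrow> poly_bounded (\<lambda>x. f x ^ k)"
  by (induction k) (simp_all add: poly_bounded_const poly_bounded_mult)

text \<open>The machine for \<open>I\<close> may leave anything on its work tapes, so
  \<open>cube_tm\<close> runs after it on tape 0 and four fresh tapes while those stay idle.\<close>

lemma poly_time_cube_graph:
  assumes "poly_time (\<lambda>w. graph_code (I w))" and inst: "\<And>w. instance_graph (I w)"
  shows "poly_time (\<lambda>w. graph_code (cube_graph (I w)))"
proof -
  from assms(1) obtain M c d where wf: "tm_wf M" and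
    M: "\<And>w. \<exists>n ts. n \<le> c * length w ^ d + c \<and>
      (tm_step M ^^ n) (tm_start M w) = (num_states M, tape_of (graph_code (I w)) # ts)"
    unfolding poly_time_def by blast
  define g where "g = (\<lambda>x. c * x ^ d + c)"
  have g: "poly_bounded g" unfolding poly_bounded_iff g_def by blast
  define k where "k = num_tapes M - 1"
  have k: "num_tapes M = Suc k" using wf by (auto simp: k_def tm_wf_def)
  define N where "N = tm_embed 0 4 M ;; tm_embed k 0 cube_tm"
  have wfN: "tm_wf N"
    unfolding N_def by (intro tm_wf_seq tm_wf_embed wf tm_wf_cube_tm) (simp add: num_tapes_cube_tm k)
  \<comment> \<open>\<open>x + g x\<close> bounds the length of the intermediate output, which
    governs the time of \<open>cube_tm\<close>.\<close>
  define T where "T = (\<lambda>x. g x + 1000 * (x + g x + 1) ^ 4)"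
  have "poly_bounded T"
    unfolding T_def by (intro poly_bounded_add poly_bounded_mult poly_bounded_power poly_bounded_const poly_bounded_id g)
  then obtain c' d' where T: "\<And>x. T x \<le> c' * x ^ d' + c'" unfolding poly_bounded_iff by blast
  have "\<exists>n ts. n \<le> T (length w) \<and>
      (tm_step N ^^ n) (tm_start N w) = (num_states N, tape_of (graph_code (cube_graph (I w))) # ts)" for w
  proof -
    let ?w = "graph_code (I w)"
    from M[of w] obtain m ts where m: "m \<le> g (length w)"
      "(tm_step M ^^ m) (tm_start M w) = (num_states M, tape_of ?w # ts)"
      unfolding g_def by blast
    from funpow_imp_tm_run[OF m(2)] m(1) obtain n where n: "n \<le> g (length w)"
      "tm_run M (tm_start M w) n (num_states M, tape_of ?w # ts)"
      using le_trans by blast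
    have start: "tm_start M w = (0, tape_of w # replicate k (tape_of []))"
      by (simp add: tm_start_def k)
    have "length ts = k"
      using tm_run_length[OF wf n(2)] by (simp add: start k)
    have "length ?w \<le> length w + g (length w)"
      using length_output_le[OF wf n(2)] n(1) by linarith
    then have le: "1000 * (length ?w + 1) ^ 4 \<le> 1000 * (length w + g (length w) + 1) ^ 4"
      by (intro mult_left_mono power_mono) auto
    have "halts_within M (tape_of w # replicate k (tape_of [])) (tape_of ?w # ts) (g (length w))"
      unfolding halts_within_def using n start by auto
    from halts_within_embed[OF wf this, of "[]" 0 "replicate 4 (tape_of [])" 4]
    have 1: "halts_within (tm_embed 0 4 M) (tape_of w # replicate k (tape_of []) @ replicate 4 (tape_of []))
        (tape_of ?w # ts @ replicate 4 (tape_of [])) (g (length w))"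
      by (simp add: k)
    from cube_tm_graph_code[OF inst, of w] obtain us where
      "halts_within cube_tm (tape_of ?w # replicate 4 (tape_of [])) (tape_of (graph_code (cube_graph (I w))) # us)
        (1000 * (length ?w + 1) ^ 4)" by blast
    from halts_within_embed[OF tm_wf_cube_tm this, of ts k "[]" 0] \<open>length ts = k\<close>
    have "halts_within (tm_embed k 0 cube_tm) (tape_of ?w # ts @ replicate 4 (tape_of []))
        (tape_of (graph_code (cube_graph (I w))) # ts @ us) (1000 * (length ?w + 1) ^ 4)"
      by (simp add: num_tapes_cube_tm)
    from halts_within_mono[OF halts_within_seq[OF 1 this], of "T (length w)"] le
    have "halts_within N (tape_of w # replicate k (tape_of []) @ replicate 4 (tape_of []))
        (tape_of (graph_code (cube_graph (I w))) # ts @ us) (T (length w))"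
      by (simp add: N_def T_def)
    moreover have "tm_start N w = (0, tape_of w # replicate k (tape_of []) @ replicate 4 (tape_of []))"
      by (simp add: tm_start_def N_def k flip: replicate_add)
    ultimately obtain n where "n \<le> T (length w)"
      "tm_run N (tm_start N w) n (num_states N, tape_of (graph_code (cube_graph (I w))) # ts @ us)"
      unfolding halts_within_def by auto
    then show ?thesis using tm_run_imp_funpow by blast
  qed
  then have "\<exists>n ts. n \<le> c' * length w ^ d' + c' \<and>
      (tm_step N ^^ n) (tm_start N w) = (num_states N, tape_of (graph_code (cube_graph (I w))) # ts)" for w
    using T[of "length w"] by (meson order_trans)
  then show ?thesis
    unfolding poly_time_def using wfN by blast
qed

section \<open>Walks of length three and subdivisions\<close>

lemma cube_graph_simps [simp]:
  "pverts (cube_graph G) = pverts G" "parcs (cube_graph G) = parcs G O parcs G O parcs G"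
  by (simp_all add: cube_graph_def)

lemma pverts_funpow_cube [simp]: "pverts ((cube_graph ^^ j) G) = pverts G"
  by (induction j) simp_all

lemma parcs_funpow_cube: "parcs ((cube_graph ^^ j) G) = parcs G ^^ (3 ^ j)"
proof (induction j)
  case (Suc j)
  have "(3::nat) ^ Suc j = 3 ^ j + (3 ^ j + 3 ^ j)" by simp
  then show ?case by (simp only: relpow_add) (simp add: Suc)
qed simp

lemma homomorphic_trans: "homomorphic F G \<Longrightarrow> homomorphic G H \<Longrightarrow> homomorphic F H"
proof -
  assume "homomorphic F G" "homomorphic G H"
  then obtain f g where "graph_hom F G f" "graph_hom G H g" unfolding homomorphic_def by blast
  then have "graph_hom F H (g \<circ> f)" by (simp add: graph_hom_def image_subset_iff)
  then show ?thesis unfolding homomorphic_def by blast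
qed

lemma homomorphic_refl: "homomorphic G G"
  unfolding homomorphic_def graph_hom_def by (rule exI[of _ "\<lambda>x. x"]) simp

lemma homomorphic_cube: "homomorphic G H \<Longrightarrow> homomorphic (cube_graph G) (cube_graph H)"
  unfolding homomorphic_def graph_hom_def by (auto simp: relcomp_unfold) blast

lemma homomorphic_funpow_cube: "homomorphic G H \<Longrightarrow> homomorphic ((cube_graph ^^ j) G) ((cube_graph ^^ j) H)"
  by (induction j) (simp_all add: homomorphic_cube)

lemma bipartite_homomorphic:
  assumes "homomorphic H G" "bipartite G" "parcs H \<subseteq> pverts H \<times> pverts H"
  shows "bipartite H"
proof -
  from assms(1,2) obtain f A B where f: "graph_hom H G f"
    and AB: "A \<inter> B = {}" "A \<union> B = pverts G" "parcs G \<subseteq> A \<times> B \<union> B \<times> A"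
    unfolding homomorphic_def bipartite_def by blast
  let ?A = "{v \<in> pverts H. f v \<in> A}" and ?B = "{v \<in> pverts H. f v \<in> B}"
  have "?A \<inter> ?B = {}" "?A \<union> ?B = pverts H"
    using AB(1,2) f by (auto simp: graph_hom_def)
  moreover have "parcs H \<subseteq> ?A \<times> ?B \<union> ?B \<times> ?A"
    using assms(3) f AB(3) unfolding graph_hom_def by blast
  ultimately show ?thesis unfolding bipartite_def by blast
qed

text \<open>Subdividing changes the vertex type, whereas the hardness assumption speaks of graphs
  over \<open>nat\<close>; renaming leads back to them.\<close>

lemma relabel_nat:
  assumes "pair_pseudo_graph G"
  obtains G' :: "nat pair_pre_digraph" where
    "pair_pseudo_graph G'" "homomorphic G G'" "homomorphic G' G"
proof -
  have G: "finite (pverts G)" "parcs G \<subseteq> pverts G \<times> pverts G" "sym (parcs G)"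
    using assms by (simp_all add: pair_pseudo_graph_iff)
  obtain f :: "_ \<Rightarrow> nat" where f: "inj_on f (pverts G)"
    using finite_imp_inj_to_nat_seg[OF G(1)] by blast
  define G' where "G' = \<lparr>pverts = f ` pverts G, parcs = map_prod f f ` parcs G\<rparr>"
  have "sym (map_prod f f ` parcs G)"
    using symD[OF G(3)] by (auto simp: sym_def)
  then have "pair_pseudo_graph G'" using G by (auto simp: pair_pseudo_graph_iff G'_def)
  moreover have "graph_hom G G' f" by (auto simp: graph_hom_def G'_def)
  moreover have "graph_hom G' G (inv_into (pverts G) f)"
    unfolding graph_hom_def G'_def using G(2) inv_into_f_f[OF f] by fastforce
  ultimately show ?thesis using that unfolding homomorphic_def by blast
qed

text \<open>An edge \<open>uv\<close> becomes the path \<open>Inl u\<close>,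
  \<open>Inr (u, v)\<close>, \<open>Inr (v, u)\<close>, \<open>Inl v\<close>; for a loop at
  \<open>u\<close>, the loop moves to \<open>Inr (u, u)\<close>.\<close>

definition subdivision3 :: "'a pair_pre_digraph \<Rightarrow> ('a + 'a \<times> 'a) pair_pre_digraph" where
  "subdivision3 G = \<lparr>pverts = Inl ` pverts G \<union> Inr ` parcs G,
     parcs = (\<Union>(u, v)\<in>parcs G. {(Inl u, Inr (u, v)), (Inr (u, v), Inl u), (Inr (u, v), Inr (v, u))})\<rparr>"

lemma pair_pseudo_graph_subdivision3: "pair_pseudo_graph G \<Longrightarrow> pair_pseudo_graph (subdivision3 G)"
proof -
  assume "pair_pseudo_graph G"
  then have G: "finite (pverts G)" "parcs G \<subseteq> pverts G \<times> pverts G" "sym (parcs G)"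
    by (simp_all add: pair_pseudo_graph_iff)
  then have "finite (parcs G)" by (meson finite_SigmaI finite_subset)
  moreover have "sym (parcs (subdivision3 G))"
    using symD[OF G(3)] by (auto simp: sym_def subdivision3_def)
  ultimately show ?thesis
    using G(1,2) symD[OF G(3)] by (auto simp: pair_pseudo_graph_iff subdivision3_def)
qed

text \<open>Each inner vertex goes to the far end of its edge, \<open>Inr (u, v)\<close> to
  \<open>v\<close>. The ends of every walk of length 3 then become adjacent in \<open>G\<close>,
  whether it crosses an edge or turns back.\<close>

lemma cube_subdivision3_homomorphic:
  assumes "pair_pseudo_graph G"
  shows "homomorphic (cube_graph (subdivision3 G)) G"
proof -
  have G: "parcs G \<subseteq> pverts G \<times> pverts G" "sym (parcs G)"
    using assms by (simp_all add: pair_pseudo_graph_iff)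
  have "graph_hom (cube_graph (subdivision3 G)) G (case_sum (\<lambda>u. u) snd)"
    using G(1) symD[OF G(2)] by (auto simp: graph_hom_def subdivision3_def)
  then show ?thesis unfolding homomorphic_def by blast
qed

text \<open>The ends of a path of length 3 lie on opposite sides, 3 being odd.\<close>

lemma bipartite_subdivision3:
  assumes "pair_pseudo_graph G" "bipartite (subdivision3 G)"
  shows "bipartite G"
proof -
  have G: "parcs G \<subseteq> pverts G \<times> pverts G" "sym (parcs G)"
    using assms by (simp_all add: pair_pseudo_graph_iff)
  from assms(2) obtain A B where AB: "A \<inter> B = {}" "A \<union> B = pverts (subdivision3 G)"
    "parcs (subdivision3 G) \<subseteq> A \<times> B \<union> B \<times> A" unfolding bipartite_def by blast
  have arc: "x \<in> A \<and> y \<in> B \<or> x \<in> B \<and> y \<in> A" if "(x, y) \<in> parcs (subdivision3 G)" for x y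
    using AB(3) that by blast
  have "(Inl u \<in> A \<and> Inl v \<in> B) \<or> (Inl u \<in> B \<and> Inl v \<in> A)" if uv: "(u, v) \<in> parcs G" for u v
  proof -
    have "(v, u) \<in> parcs G" using uv symD[OF G(2)] by blast
    then have "(Inl u, Inr (u, v)) \<in> parcs (subdivision3 G)" "(Inr (u, v), Inr (v, u)) \<in> parcs (subdivision3 G)"
      "(Inr (v, u), Inl v) \<in> parcs (subdivision3 G)"
      using uv by (auto simp: subdivision3_def)
    from this[THEN arc] AB(1) show ?thesis by blast
  qed
  then have "parcs G \<subseteq> Inl -` A \<times> Inl -` B \<union> Inl -` B \<times> Inl -` A" by auto
  moreover have "Inl -` A \<inter> Inl -` B = {}" "Inl -` A \<union> Inl -` B = pverts G"
    using AB(1,2) by (auto simp: subdivision3_def)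
  ultimately show ?thesis unfolding bipartite_def by blast
qed

text \<open>The induction hypothesis is applied to the relabelled subdivision of \<open>H\<close>,
  so \<open>H\<close> has to vary.\<close>

lemma nonbipartite_cube_preimage:
  fixes H :: "nat pair_pre_digraph"
  assumes "pair_pseudo_graph H" "\<not> bipartite H"
  shows "\<exists>H' :: nat pair_pre_digraph. pair_pseudo_graph H' \<and> \<not> bipartite H' \<and> homomorphic ((cube_graph ^^ j) H') H"
  using assms
proof (induction j arbitrary: H)
  case 0
  then show ?case using homomorphic_refl by auto
next
  case (Suc j)
  note sub = pair_pseudo_graph_subdivision3[OF Suc.prems(1)]
  obtain H1 :: "nat pair_pre_digraph" where H1: "pair_pseudo_graph H1"
    "homomorphic (subdivision3 H) H1" "homomorphic H1 (subdivision3 H)"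
    using relabel_nat[OF sub] by blast
  have "\<not> bipartite H1"
    using bipartite_homomorphic[OF H1(2)] bipartite_subdivision3 Suc.prems sub
    by (auto simp: pair_pseudo_graph_iff)
  then obtain H' :: "nat pair_pre_digraph" where H': "pair_pseudo_graph H'" "\<not> bipartite H'"
    "homomorphic ((cube_graph ^^ j) H') H1"
    using Suc.IH[OF H1(1)] by blast
  have "homomorphic ((cube_graph ^^ Suc j) H') (cube_graph H1)"
    using homomorphic_cube[OF H'(3)] by simp
  then have "homomorphic ((cube_graph ^^ Suc j) H') H"
    by (rule homomorphic_trans[OF homomorphic_trans[OF _ homomorphic_cube[OF H1(3)]]
          cube_subdivision3_homomorphic[OF Suc.prems(1)]])
  then show ?case using H' by blast
qed

section \<open>Geometric realisations\<close>

lemma realisationD: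
  assumes "x \<in> realisation K"
  shows "0 \<le> x v" "{v. x v \<noteq> 0} \<in> K" "(\<Sum>v | x v \<noteq> 0. x v) = 1"
  using assms by (auto simp: realisation_def)

lemma realisation_finite_support: "x \<in> realisation K \<Longrightarrow> finite {v. x v \<noteq> 0}"
  using realisationD(3) by (metis sum.infinite zero_neq_one)

lemma realisation_le_1: "x \<in> realisation K \<Longrightarrow> x v \<le> 1"
proof (cases "x v = 0")
  case False
  assume x: "x \<in> realisation K"
  have "x v \<le> (\<Sum>v | x v \<noteq> 0. x v)"
    using False realisationD(1)[OF x] realisation_finite_support[OF x] by (intro member_le_sum) auto
  then show ?thesis using realisationD(3)[OF x] by simp
qed simp

lemma tendsto_fun_componentwise:
  fixes f :: "'c \<Rightarrow> 'a \<Rightarrow> 'b::topological_space"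
  assumes "\<And>v. ((\<lambda>n. f n v) \<longlongrightarrow> l v) F"
  shows "(f \<longlongrightarrow> l) F"
  using assms limitin_componentwise[of "\<lambda>_. euclidean" UNIV f l F]
  by (simp add: euclidean_product_topology)

text \<open>Sequential compactness: finitely many bounded coordinates converge along a subsequence,
  and the support of the limit is a non-empty subset of a face.\<close>

lemma realisation_subsequence:
  fixes x :: "nat \<Rightarrow> 'v \<Rightarrow> real"
  assumes "finite A" "\<Union>K \<subseteq> A" "\<And>\<sigma> \<tau>. \<sigma> \<in> K \<Longrightarrow> \<tau> \<subseteq> \<sigma> \<Longrightarrow> \<tau> \<noteq> {} \<Longrightarrow> \<tau> \<in> K"
    and x: "\<And>n. x n \<in> realisation K"
  shows "\<exists>l\<in>realisation K. \<exists>r :: nat \<Rightarrow> nat. strict_mono r \<and> (\<forall>v. (\<lambda>n. x (r n) v) \<longlonglongrightarrow> l v)"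
proof -
  have zero: "x n v = 0" if "v \<notin> A" for n v
    using realisationD(2)[OF x[of n]] assms(2) that by auto
  have "\<forall>d\<subseteq>A. \<exists>l r. strict_mono (r :: nat \<Rightarrow> nat) \<and>
      (\<forall>e>0. \<forall>\<^sub>F n in sequentially. \<forall>i\<in>d. dist (x (r n) i) (l i) < e)"
  proof (rule compact_lemma_general[where unproj = "\<lambda>x. x"])
    show "bounded ((\<lambda>x. x k) ` range x)" for k
      using realisationD(1)[OF x] realisation_le_1[OF x]
      by (intro boundedI[of _ 1]) (auto simp: abs_le_iff intro: order_trans[of _ 0])
  qed (use assms(1) in simp_all)
  then obtain l' and r :: "nat \<Rightarrow> nat" where r: "strict_mono r"
    and l': "\<And>e. e > 0 \<Longrightarrow> \<forall>\<^sub>F n in sequentially. \<forall>i\<in>A. dist (x (r n) i) (l' i) < e"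
    by blast
  \<comment> \<open>\<open>l'\<close> is controlled on \<open>A\<close> only; outside
    \<open>A\<close> all points of the realisation vanish.\<close>
  define l where "l = (\<lambda>v. if v \<in> A then l' v else 0)"
  have lim: "(\<lambda>n. x (r n) v) \<longlonglongrightarrow> l v" for v
  proof (cases "v \<in> A")
    case True
    then show ?thesis
      unfolding tendsto_iff l_def by (auto intro: eventually_mono[OF l'])
  next
    case False
    then show ?thesis by (simp add: zero l_def)
  qed
  have sum_A: "(\<Sum>v | y v \<noteq> 0. y v) = (\<Sum>v\<in>A. y v)" if "\<And>v. v \<notin> A \<Longrightarrow> y v = 0" for y :: "'v \<Rightarrow> real"
    using that assms(1) by (intro sum.mono_neutral_left) auto
  have "(\<lambda>n. \<Sum>v\<in>A. x (r n) v) \<longlonglongrightarrow> (\<Sum>v\<in>A. l v)"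
    by (intro tendsto_sum lim)
  moreover have "(\<Sum>v\<in>A. x (r n) v) = 1" for n
    using realisationD(3)[OF x] sum_A[of "x (r n)"] zero by simp
  ultimately have "(\<Sum>v\<in>A. l v) = 1"
    by (simp add: LIMSEQ_const_iff)
  then have sum1: "(\<Sum>v | l v \<noteq> 0. l v) = 1"
    by (subst sum_A) (auto simp: l_def)
  \<comment> \<open>A coordinate with non-zero limit is eventually non-zero, so some
    \<open>x (r n)\<close> is non-zero on the whole support of \<open>l\<close>.\<close>
  have "\<forall>\<^sub>F n in sequentially. \<forall>v\<in>{v. l v \<noteq> 0}. x (r n) v \<noteq> 0"
  proof (rule eventually_ball_finite)
    show "finite {v. l v \<noteq> 0}"
      by (rule finite_subset[OF _ assms(1)]) (auto simp: l_def)
    show "\<forall>v\<in>{v. l v \<noteq> 0}. \<forall>\<^sub>F n in sequentially. x (r n) v \<noteq> 0"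
      using lim tendsto_imp_eventually_ne by blast
  qed
  then obtain n where "\<forall>v\<in>{v. l v \<noteq> 0}. x (r n) v \<noteq> 0"
    using eventually_happens by force
  then have "{v. l v \<noteq> 0} \<subseteq> {v. x (r n) v \<noteq> 0}" by blast
  moreover have "{v. l v \<noteq> 0} \<noteq> {}" using sum1 by (metis sum.empty zero_neq_one)
  ultimately have "{v. l v \<noteq> 0} \<in> K"
    using assms(3) realisationD(2)[OF x] by blast
  moreover have "0 \<le> l v" for v
    by (rule LIMSEQ_le_const[OF lim]) (use realisationD(1)[OF x] in auto)
  ultimately have "l \<in> realisation K" using sum1 by (simp add: realisation_def)
  then show ?thesis using r lim by blast
qed

text \<open>Heine-Cantor by sequences: pairs violating ever smaller \<open>\<delta>\<close> have
  subsequences with a common limit, against continuity there.\<close>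

lemma realisation_uniformly_continuous:
  fixes \<phi> :: "('v \<Rightarrow> real) \<Rightarrow> ('w \<Rightarrow> real)"
  assumes "finite A" "\<Union>K \<subseteq> A" "\<And>\<sigma> \<tau>. \<sigma> \<in> K \<Longrightarrow> \<tau> \<subseteq> \<sigma> \<Longrightarrow> \<tau> \<noteq> {} \<Longrightarrow> \<tau> \<in> K"
    and "finite B" "continuous_on (realisation K) \<phi>" "0 < \<epsilon>"
  shows "\<exists>\<delta>>0. \<forall>x\<in>realisation K. \<forall>y\<in>realisation K. (\<forall>v. \<bar>x v - y v\<bar> < \<delta>) \<longrightarrow>
    (\<forall>e\<in>B. \<bar>\<phi> x e - \<phi> y e\<bar> < \<epsilon>)"
proof (rule ccontr)
  assume contr: "\<not> ?thesis"
  have "\<exists>x y e. x \<in> realisation K \<and> y \<in> realisation K \<and> (\<forall>v. \<bar>x v - y v\<bar> < inverse (real (Suc n))) \<and> e \<in> B \<and>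
       \<not> \<bar>\<phi> x e - \<phi> y e\<bar> < \<epsilon>" for n
  proof -
    have "0 < inverse (real (Suc n))" by simp
    then show ?thesis using contr by blast
  qed
  then obtain x y e where
    x: "\<And>n. x n \<in> realisation K" and y: "\<And>n. y n \<in> realisation K"
    and close: "\<And>n v. \<bar>x n v - y n v\<bar> < inverse (real (Suc n))"
    and far: "\<And>n. e n \<in> B" "\<And>n. \<not> \<bar>\<phi> (x n) (e n) - \<phi> (y n) (e n)\<bar> < \<epsilon>"
    by metis
  obtain l r where l: "l \<in> realisation K" and r: "strict_mono (r :: nat \<Rightarrow> nat)"
    and xl: "\<And>v. (\<lambda>n. x (r n) v) \<longlonglongrightarrow> l v"
    using realisation_subsequence[of A K x] assms(1-3) x by blast
  have yl: "(\<lambda>n. y (r n) v) \<longlonglongrightarrow> l v" for v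
  proof -
    have "(\<lambda>n. x n v - y n v) \<longlonglongrightarrow> 0"
      by (rule Lim_null_comparison[OF _ LIMSEQ_inverse_real_of_nat])
         (use close in \<open>auto intro!: always_eventually less_imp_le simp del: of_nat_Suc\<close>)
    then have "(\<lambda>n. x (r n) v - y (r n) v) \<longlonglongrightarrow> 0"
      using r LIMSEQ_subseq_LIMSEQ unfolding o_def by fastforce
    from tendsto_diff[OF xl[of v] this] show ?thesis by simp
  qed
  have \<phi>: "(\<lambda>n. \<phi> (z (r n)) c) \<longlonglongrightarrow> \<phi> l c"
    if "\<And>n. z n \<in> realisation K" "\<And>v. (\<lambda>n. z (r n) v) \<longlonglongrightarrow> l v" for z c
    using continuous_on_tendsto_compose[OF continuous_on_product_then_coordinatewise[OF assms(5), of c]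
        tendsto_fun_componentwise[of "\<lambda>n. z (r n)"] l] that by simp
  have "\<forall>\<^sub>F n in sequentially. \<forall>c\<in>B. \<bar>\<phi> (x (r n)) c - \<phi> (y (r n)) c\<bar> < \<epsilon>"
  proof (rule eventually_ball_finite[OF assms(4)], rule ballI)
    fix c
    have "(\<lambda>n. \<phi> (x (r n)) c - \<phi> (y (r n)) c) \<longlonglongrightarrow> 0"
      using tendsto_diff[OF \<phi>[OF x xl, of c] \<phi>[OF y yl, of c]] by simp
    from tendstoD[OF this assms(6)] show "\<forall>\<^sub>F n in sequentially. \<bar>\<phi> (x (r n)) c - \<phi> (y (r n)) c\<bar> < \<epsilon>"
      by (simp add: dist_real_def)
  qed
  then obtain n where "\<forall>c\<in>B. \<bar>\<phi> (x (r n)) c - \<phi> (y (r n)) c\<bar> < \<epsilon>"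
    using eventually_happens by force
  then show False using far by blast
qed

text \<open>\<open>d / D\<close> lies between \<open>c / (C + N)\<close> and
  \<open>(c + 1) / C\<close>, both within \<open>(N + 1) / C\<close> of
  \<open>c / C\<close>.\<close>

lemma normalised_diff_le:
  fixes c d C D N :: real
  assumes "0 \<le> c" "c \<le> d" "d \<le> c + 1" "c \<le> C" "C \<le> D" "D \<le> C + N" "0 < C" "0 \<le> N"
  shows "\<bar>c / C - d / D\<bar> \<le> (N + 1) / C"
proof -
  have "d / D \<le> (c + 1) / C" using assms by (intro frac_le) auto
  moreover have "c / C - c / (C + N) \<le> N / C"
  proof -
    have "c / C - c / (C + N) = (c / (C + N)) * (N / C)"
      using assms by (simp add: field_simps)
    also have "\<dots> \<le> 1 * (N / C)" using assms by (intro mult_right_mono) auto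
    finally show ?thesis by simp
  qed
  moreover have "c / (C + N) \<le> d / D" using assms by (intro frac_le) auto
  ultimately show ?thesis using assms by (auto simp: add_divide_distrib abs_le_iff)
      (smt (verit) divide_nonneg_nonneg)+
qed

section \<open>Weights from the layers of walks around a vertex\<close>

locale walk_layers =
  fixes E :: "('i \<times> 'i) set" and h :: "'i \<Rightarrow> 'a" and W :: "'a set"
  assumes sym_E: "sym E" and finite_W: "finite W" and h_W: "h ` Domain E \<subseteq> W"
begin

text \<open>\<open>h\<close> is to be the homomorphism from the iterated cube to \<open>G\<close>.
  Outside \<open>Domain E\<close> there are no walks of positive length, hence the restriction to
  \<open>Domain E\<close> below.\<close>

definition layer :: "nat \<Rightarrow> 'i \<Rightarrow> 'a set" where
  "layer m i = h ` ((E ^^ m) `` {i})"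

text \<open>
  The layers of radius \<open>m, m - 2, \<dots>\<close> around \<open>i\<close> are nested, and interleave with those of radius
  \<open>m + 1, m - 1, \<dots>\<close> around a neighbour. Hence the weights below change by at most one along an arc.
\<close>

definition weight :: "nat \<Rightarrow> 'i \<Rightarrow> 'a \<Rightarrow> nat" where
  "weight m i v = card {s. 2 * s \<le> m \<and> v \<in> layer (m - 2 * s) i}"

definition total :: "nat \<Rightarrow> 'i \<Rightarrow> nat" where
  "total m i = (\<Sum>v\<in>W. weight m i v)"

definition share :: "nat \<Rightarrow> 'i \<Rightarrow> 'a \<Rightarrow> real" where
  "share m i v = real (weight m i v) / real (total m i)"

lemma finite_weight: "finite {s. 2 * s \<le> m \<and> v \<in> layer (m - 2 * s) i}"
  by (rule finite_subset[of _ "{..m}"]) auto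

lemma sym_relpow: "(x, y) \<in> E ^^ m \<Longrightarrow> (y, x) \<in> E ^^ m"
proof (induction m arbitrary: y)
  case (Suc m)
  then obtain z where "(x, z) \<in> E ^^ m" "(z, y) \<in> E" by auto
  then show ?case using Suc.IH symD[OF sym_E] relpow_Suc_I2 by metis
qed simp

lemma relpow_Domain: "i \<in> Domain E \<Longrightarrow> (i, y) \<in> E ^^ m \<Longrightarrow> y \<in> Domain E"
  by (cases m) (auto dest: symD[OF sym_E])

lemma layer_subset_W: "i \<in> Domain E \<Longrightarrow> layer m i \<subseteq> W"
  using relpow_Domain h_W by (fastforce simp: layer_def)

lemma layer_step: "(i, i') \<in> E \<Longrightarrow> layer m i \<subseteq> layer (Suc m) i'"
  unfolding layer_def using relpow_Suc_I2 symD[OF sym_E] by (fastforce simp del: relpow.simps)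

text \<open>Two further steps can be spent at the start, to a neighbour and back.\<close>

lemma layer_add_even: "i \<in> Domain E \<Longrightarrow> layer m i \<subseteq> layer (m + 2 * s) i"
proof (induction s)
  case (Suc s)
  then obtain i' where i': "(i, i') \<in> E" by blast
  then have "layer (m + 2 * s) i \<subseteq> layer (Suc (Suc (m + 2 * s))) i"
    using layer_step[OF i'] layer_step[OF symD[OF sym_E i']] by blast
  then show ?case using Suc by auto
qed simp

lemma layer_nonempty: "i \<in> Domain E \<Longrightarrow> layer m i \<noteq> {}"
proof -
  assume i: "i \<in> Domain E"
  have "\<exists>y. (i, y) \<in> E ^^ m"
  proof (induction m)
    case (Suc m)
    then show ?case using relpow_Domain[OF i] by (meson DomainE relpow_Suc_I)
  qed auto
  then show ?thesis by (auto simp: layer_def)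
qed

text \<open>By nesting, the layer for \<open>s = 0\<close> contains all others that are counted. So
  shares are supported exactly on \<open>layer m i\<close>.\<close>

lemma weight_eq_0_iff: "i \<in> Domain E \<Longrightarrow> weight m i v = 0 \<longleftrightarrow> v \<notin> layer m i"
proof -
  assume i: "i \<in> Domain E"
  have "layer (m - 2 * s) i \<subseteq> layer m i" if "2 * s \<le> m" for s
    using layer_add_even[OF i, of "m - 2 * s" s] that by simp
  then show ?thesis
    using finite_weight[of m v i] by (auto simp: weight_def) (metis diff_zero mult_0_right zero_le)
qed

text \<open>An index \<open>s\<close> counted at \<open>i\<close> is also counted at
  \<open>i'\<close>, and an index \<open>s > 0\<close> counted at \<open>i'\<close> comes from
  \<open>s - 1\<close> at \<open>i\<close>; only \<open>s = 0\<close> can be new.\<close>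

lemma weight_step:
  assumes "(i, i') \<in> E"
  shows "weight m i v \<le> weight (Suc m) i' v" "weight (Suc m) i' v \<le> Suc (weight m i v)"
proof -
  let ?S = "{s. 2 * s \<le> m \<and> v \<in> layer (m - 2 * s) i}"
  let ?S' = "{s. 2 * s \<le> Suc m \<and> v \<in> layer (Suc m - 2 * s) i'}"
  have "?S \<subseteq> ?S'"
    using subsetD[OF layer_step[OF assms]] by (auto simp: Suc_diff_le)
  then show "weight m i v \<le> weight (Suc m) i' v"
    unfolding weight_def by (rule card_mono[OF finite_weight])
  have "?S' \<subseteq> insert 0 (Suc ` ?S)"
  proof
    fix s assume s: "s \<in> ?S'"
    show "s \<in> insert 0 (Suc ` ?S)"
    proof (cases s)
      case (Suc t)
      have "2 * t \<le> m" "Suc (Suc m - 2 * s) = m - 2 * t" using s Suc by auto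
      then have "t \<in> ?S"
        using layer_step[OF symD[OF sym_E assms], of "Suc m - 2 * s"] s by auto
      then show ?thesis using Suc by blast
    qed simp
  qed
  then have "card ?S' \<le> card (insert 0 (Suc ` ?S))"
    by (intro card_mono) (auto simp: finite_weight)
  also have "\<dots> \<le> Suc (card ?S)"
    by (simp add: card_insert_if card_image finite_weight)
  finally show "weight (Suc m) i' v \<le> Suc (weight m i v)" unfolding weight_def .
qed

text \<open>A vertex in the innermost layer, of radius \<open>m mod 2\<close>, is counted by all
  \<open>m div 2 + 1\<close> indices. So the normalising denominator grows with \<open>m\<close>,
  while weights change by at most one.\<close>

lemma total_ge: "i \<in> Domain E \<Longrightarrow> m < 2 * total m i"
proof -
  assume i: "i \<in> Domain E"
  obtain v where v: "v \<in> layer (m mod 2) i" using layer_nonempty[OF i] by blast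
  have "v \<in> layer (m - 2 * s) i" if "s \<le> m div 2" for s
  proof -
    have "m - 2 * s = m mod 2 + 2 * (m div 2 - s)" using that by presburger
    then show ?thesis using layer_add_even[OF i, of "m mod 2" "m div 2 - s"] v by auto
  qed
  then have "{..m div 2} \<subseteq> {s. 2 * s \<le> m \<and> v \<in> layer (m - 2 * s) i}" by auto
  from card_mono[OF finite_weight this] have "Suc (m div 2) \<le> weight m i v"
    by (simp add: weight_def)
  also have "\<dots> \<le> total m i"
    unfolding total_def using v layer_subset_W[OF i] by (intro member_le_sum) (auto simp: finite_W)
  finally show ?thesis by presburger
qed

lemma share_nonneg: "0 \<le> share m i v"
  by (simp add: share_def)

lemma share_eq_0_iff: "i \<in> Domain E \<Longrightarrow> share m i v = 0 \<longleftrightarrow> v \<notin> layer m i"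
  using total_ge[of i m] weight_eq_0_iff[of i m v] by (auto simp: share_def)

lemma sum_share: "i \<in> Domain E \<Longrightarrow> (\<Sum>v\<in>layer m i. share m i v) = 1"
proof -
  assume i: "i \<in> Domain E"
  have "(\<Sum>v\<in>layer m i. share m i v) = (\<Sum>v\<in>W. share m i v)"
    using layer_subset_W[OF i] share_eq_0_iff[OF i] by (intro sum.mono_neutral_left finite_W) auto
  also have "\<dots> = 1"
    using total_ge[OF i, of m] by (simp add: share_def total_def flip: sum_divide_distrib of_nat_sum)
  finally show ?thesis .
qed

lemma share_le_1:
  assumes i: "i \<in> Domain E"
  shows "share m i v \<le> 1"
proof (cases "v \<in> layer m i")
  case True
  have "share m i v \<le> (\<Sum>v\<in>layer m i. share m i v)"
    using True finite_subset[OF layer_subset_W[OF i] finite_W]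
    by (intro member_le_sum) (auto simp: share_nonneg)
  then show ?thesis by (simp add: sum_share[OF i])
next
  case False
  then have "share m i v = 0" using share_eq_0_iff[OF i] by blast
  then show ?thesis by simp
qed

lemma share_step:
  assumes "(i, i') \<in> E"
  shows "\<bar>share m i v - share (Suc m) i' v\<bar> \<le> 2 * (real (card W) + 1) / (real m + 1)"
proof -
  have i: "i \<in> Domain E" "i' \<in> Domain E" using assms symD[OF sym_E] by auto
  have tot: "total m i \<le> total (Suc m) i'"
    unfolding total_def by (intro sum_mono weight_step(1)[OF assms])
  \<comment> \<open>Each of the \<open>card W\<close> weights grows by at most one.\<close>
  have "total (Suc m) i' \<le> (\<Sum>v\<in>W. weight m i v + 1)"
    unfolding total_def using weight_step(2)[OF assms] by (intro sum_mono) simp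
  then have tot': "total (Suc m) i' \<le> total m i + card W"
    unfolding total_def by (simp only: sum.distrib card_eq_sum)
  have pos: "m < 2 * total m i" by (rule total_ge[OF i(1)])
  have "weight m i v \<le> total m i"
  proof (cases "v \<in> W")
    case True
    then show ?thesis unfolding total_def by (intro member_le_sum) (auto simp: finite_W)
  next
    case False
    then show ?thesis using weight_eq_0_iff[OF i(1)] layer_subset_W[OF i(1)] by (metis le0 subsetD)
  qed
  then have "\<bar>share m i v - share (Suc m) i' v\<bar> \<le> (real (card W) + 1) / real (total m i)"
    unfolding share_def using weight_step[OF assms, of m v] tot tot' pos
    by (intro normalised_diff_le) auto
  also have "\<dots> \<le> (real (card W) + 1) / ((real m + 1) / 2)"
    using pos by (intro divide_left_mono) auto
  finally show ?thesis by (simp add: mult.commute)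
qed

end

section \<open>From maps of realisations to graph homomorphisms\<close>

lemma product_in_realisation:
  assumes "\<And>a. 0 \<le> \<mu> a" "\<And>b. 0 \<le> \<nu> b"
    and "\<And>a. \<mu> a \<noteq> 0 \<longleftrightarrow> a \<in> U" "\<And>b. \<nu> b \<noteq> 0 \<longleftrightarrow> b \<in> V"
    and "(\<Sum>a\<in>U. \<mu> a) = 1" "(\<Sum>b\<in>V. \<nu> b) = 1"
    and "U \<subseteq> pverts G" "V \<subseteq> pverts G" "U \<times> V \<subseteq> parcs G"
  shows "(\<lambda>(a, b). \<mu> a * \<nu> b) \<in> realisation (hom_complex G)"
proof -
  have supp: "{e. (case e of (a, b) \<Rightarrow> \<mu> a * \<nu> b) \<noteq> 0} = U \<times> V"
    using assms(3,4) by (auto simp flip: assms(3,4))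
  have "(\<Sum>e\<in>U \<times> V. case e of (a, b) \<Rightarrow> \<mu> a * \<nu> b) = (\<Sum>a\<in>U. \<mu> a) * (\<Sum>b\<in>V. \<nu> b)"
    by (simp add: sum_product sum.cartesian_product)
  moreover have "U \<noteq> {}" "V \<noteq> {}" using assms(5,6) by auto
  then have "U \<times> V \<in> hom_complex G" using assms(7-9) by (auto simp: hom_complex_def)
  ultimately show ?thesis
    unfolding realisation_def mem_Collect_eq supp using assms(1,2,5,6) by (auto simp: split_def)
qed

lemma abs_mult_diff_le:
  fixes p q p' q' :: real
  assumes "0 \<le> q" "q \<le> 1" "0 \<le> p'" "p' \<le> 1"
  shows "\<bar>p * q - p' * q'\<bar> \<le> \<bar>p - p'\<bar> + \<bar>q - q'\<bar>"
proof -
  have "p * q - p' * q' = (p - p') * q + p' * (q - q')" by (simp add: algebra_simps)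
  also have "\<bar>\<dots>\<bar> \<le> \<bar>p - p'\<bar> * q + p' * \<bar>q - q'\<bar>"
    using abs_triangle_ineq[of "(p - p') * q" "p' * (q - q')"] assms by (simp add: abs_mult)
  also have "\<dots> \<le> \<bar>p - p'\<bar> * 1 + 1 * \<bar>q - q'\<bar>"
    using assms by (intro add_mono mult_left_mono mult_right_mono) auto
  finally show ?thesis by simp
qed

text \<open>\<open>x i\<close> is the product of the shares of radii \<open>l\<close> and
  \<open>l + 1\<close>, which \<open>flip\<close> exchanges. Comparing \<open>x i\<close> with
  \<open>flip (x i')\<close> thus compares shares at neighbours with radii differing by one, as in
  \<open>share_step\<close>.\<close>

lemma antipodal_points:
  assumes "pair_pseudo_graph G" "pair_pseudo_graph I" "homomorphic ((cube_graph ^^ j) I) G"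
  shows "\<exists>x. (\<forall>i\<in>Domain (parcs I). x i \<in> realisation (hom_complex G) \<and> flip (x i) \<in> realisation (hom_complex G)) \<and>
    (\<forall>i i' e. (i, i') \<in> parcs I \<longrightarrow>
       \<bar>x i e - flip (x i') e\<bar> \<le> 4 * (real (card (pverts G)) + 1) / (real j + 1))"
proof -
  from assms(3) obtain h where h: "graph_hom ((cube_graph ^^ j) I) G h" unfolding homomorphic_def by blast
  have G: "finite (pverts G)" "sym (parcs G)" and I: "parcs I \<subseteq> pverts I \<times> pverts I" "sym (parcs I)"
    using assms(1,2) by (simp_all add: pair_pseudo_graph_iff)
  have "h ` Domain (parcs I) \<subseteq> pverts G"
    using h I(1) by (auto simp: graph_hom_def)
  then interpret walk_layers "parcs I" h "pverts G"
    by unfold_locales (use G I in auto)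
  define l where "l = (3 ^ j - 1 :: nat) div 2"
  have "odd ((3::nat) ^ j)" by simp
  then have l: "3 ^ j = l + Suc l" unfolding l_def by presburger
  \<comment> \<open>\<open>l\<close> grows exponentially, but \<open>j \<le> l\<close> suffices for
    a bound that tends to 0 with growing \<open>j\<close>.\<close>
  have "2 * j + 1 \<le> (3::nat) ^ j" by (induction j) auto
  then have jl: "j \<le> l" using l by linarith
  \<comment> \<open>Reversing the walk to \<open>a\<close> and appending the one to \<open>b\<close>
    gives a walk of length \<open>3 ^ j\<close>, which \<open>h\<close> maps to an arc.\<close>
  have arcs: "layer l i \<times> layer (Suc l) i \<subseteq> parcs G" for i
  proof -
    have "(h a, h b) \<in> parcs G" if "(i, a) \<in> parcs I ^^ l" "(i, b) \<in> parcs I ^^ Suc l" for a b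
    proof -
      have "(a, b) \<in> parcs I ^^ (l + Suc l)"
        using sym_relpow[OF that(1)] that(2) unfolding relpow_add by blast
      then show ?thesis using h by (simp add: graph_hom_def parcs_funpow_cube l)
    qed
    then show ?thesis unfolding layer_def by blast
  qed
  then have arcs': "layer (Suc l) i \<times> layer l i \<subseteq> parcs G" for i
    using symD[OF G(2)] by blast
  define x where "x = (\<lambda>i (a, b). share l i a * share (Suc l) i b)"
  show ?thesis
  proof (intro exI[of _ x] conjI ballI allI impI)
    fix i assume i: "i \<in> Domain (parcs I)"
    show "x i \<in> realisation (hom_complex G)"
      unfolding x_def
      by (rule product_in_realisation[of _ _ "layer l i" "layer (Suc l) i"])
         (use i in \<open>auto simp: share_nonneg share_eq_0_iff sum_share intro: subsetD[OF layer_subset_W] subsetD[OF arcs]\<close>)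
    have "flip (x i) = (\<lambda>(a, b). share (Suc l) i a * share l i b)"
      by (auto simp: flip_def x_def fun_eq_iff)
    also have "\<dots> \<in> realisation (hom_complex G)"
      by (rule product_in_realisation[of _ _ "layer (Suc l) i" "layer l i"])
         (use i in \<open>auto simp: share_nonneg share_eq_0_iff sum_share intro: subsetD[OF layer_subset_W] subsetD[OF arcs']\<close>)
    finally show "flip (x i) \<in> realisation (hom_complex G)" .
  next
    fix i i' and e :: "'a \<times> 'a"
    assume ii': "(i, i') \<in> parcs I"
    then have i'i: "(i', i) \<in> parcs I" by (rule symD[OF I(2)])
    obtain a b where e: "e = (a, b)" by fastforce
    let ?\<eta> = "2 * (real (card (pverts G)) + 1) / (real l + 1)"
    have "\<bar>x i e - flip (x i') e\<bar> = \<bar>share l i a * share (Suc l) i b - share (Suc l) i' a * share l i' b\<bar>"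
      by (simp add: x_def flip_def e mult.commute)
    also have "\<dots> \<le> \<bar>share l i a - share (Suc l) i' a\<bar> + \<bar>share (Suc l) i b - share l i' b\<bar>"
      using ii' i'i by (intro abs_mult_diff_le) (auto simp: share_nonneg intro!: share_le_1)
    also have "\<dots> \<le> ?\<eta> + ?\<eta>"
      using share_step[OF ii', of l a] share_step[OF i'i, of l b] by linarith
    also have "\<dots> = 4 * (real (card (pverts G)) + 1) / (real l + 1)" by simp
    also have "\<dots> \<le> 4 * (real (card (pverts G)) + 1) / (real j + 1)"
      using jl by (intro divide_left_mono) auto
    finally show "\<bar>x i e - flip (x i') e\<bar> \<le> 4 * (real (card (pverts G)) + 1) / (real j + 1)" .
  qed
qed

lemma finite_parcs: "pair_pseudo_graph G \<Longrightarrow> finite (parcs G)"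
  unfolding pair_pseudo_graph_iff by (meson finite_SigmaI finite_subset)

lemma Union_hom_complex: "\<Union>(hom_complex G) \<subseteq> parcs G"
  unfolding hom_complex_def by blast

lemma hom_complex_subset: "\<sigma> \<in> hom_complex G \<Longrightarrow> \<tau> \<subseteq> \<sigma> \<Longrightarrow> \<tau> \<noteq> {} \<Longrightarrow> \<tau> \<in> hom_complex G"
  unfolding hom_complex_def by blast

text \<open>Averaging: the coordinates sum to 1 and live on at most \<open>card (parcs G)\<close>
  arcs.\<close>

lemma realisation_heavy_arc:
  assumes "pair_pseudo_graph G" "y \<in> realisation (hom_complex G)"
  shows "\<exists>e\<in>parcs G. 1 / real (card (parcs G)) \<le> y e"
proof (rule ccontr)
  assume contr: "\<not> ?thesis"
  let ?S = "{e. y e \<noteq> 0}" and ?M = "real (card (parcs G))"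
  have sub: "?S \<subseteq> parcs G" using realisationD(2)[OF assms(2)] Union_hom_complex by blast
  have "?S \<noteq> {}" using realisationD(3)[OF assms(2)] by (metis sum.empty zero_neq_one)
  have lt: "y e < 1 / ?M" if "e \<in> ?S" for e
    using contr that sub by (meson linorder_not_le subsetD)
  have "1 = (\<Sum>e\<in>?S. y e)" using realisationD(3)[OF assms(2)] by simp
  also have "\<dots> < (\<Sum>e\<in>?S. 1 / ?M)"
    using \<open>?S \<noteq> {}\<close> finite_subset[OF sub finite_parcs[OF assms(1)]] lt by (intro sum_strict_mono) auto
  also have "\<dots> = real (card ?S) / ?M" by simp
  also have "\<dots> \<le> 1"
    using card_mono[OF finite_parcs[OF assms(1)] sub] by (auto simp: divide_le_eq_1)
  finally show False by simp
qed

text \<open>The support lies in a product \<open>U \<times> V\<close> of arcs, so the ends of two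
  supporting arcs can be recombined.\<close>

lemma realisation_support_arc:
  assumes "y \<in> realisation (hom_complex G)" "y (a, b) \<noteq> 0" "y (c, d) \<noteq> 0"
  shows "(a, d) \<in> parcs G"
proof -
  obtain U V where UV: "{e. y e \<noteq> 0} \<subseteq> U \<times> V" "U \<times> V \<subseteq> parcs G"
    using realisationD(2)[OF assms(1)] unfolding hom_complex_def by auto
  have "(a, b) \<in> U \<times> V" "(c, d) \<in> U \<times> V" using UV(1) assms(2,3) by auto
  then show ?thesis using UV(2) by auto
qed

text \<open>\<open>j\<close> can be fixed before \<open>I\<close>: the modulus
  \<open>\<delta>\<close> comes from \<open>f\<close> alone, and the bound in
  \<open>antipodal_points\<close> is independent of \<open>I\<close>.\<close>

lemma Z2_map_imp_homomorphic:
  fixes G :: "'a pair_pre_digraph" and G' :: "'b pair_pre_digraph"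
  assumes G: "pair_pseudo_graph G" and G': "pair_pseudo_graph G'"
    and f: "Z2_map (realisation (hom_complex G)) flip (realisation (hom_complex G')) flip f"
    and ne: "parcs G \<noteq> {}"
  shows "\<exists>j. \<forall>I :: 'i pair_pre_digraph. pair_pseudo_graph I \<longrightarrow> homomorphic ((cube_graph ^^ j) I) G \<longrightarrow> homomorphic I G'"
proof -
  let ?X = "realisation (hom_complex G)" and ?Y = "realisation (hom_complex G')"
  let ?M = "real (card (parcs G'))"
  have cont: "continuous_on ?X f" and fY: "\<And>x. x \<in> ?X \<Longrightarrow> f x \<in> ?Y" and equi: "\<And>x. x \<in> ?X \<Longrightarrow> f (flip x) = flip (f x)"
    using f by (auto simp: Z2_map_def)
  obtain u v where uv: "(u, v) \<in> parcs G" using ne by auto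
  \<comment> \<open>The image of the vertex \<open>(u, v)\<close> of the complex supplies an arc
    \<open>e0\<close> of \<open>G'\<close>, whence \<open>?M\<close> is positive.\<close>
  have "(\<lambda>(a, b). of_bool (a = u) * of_bool (b = v)) \<in> ?X"
    by (rule product_in_realisation[of _ _ "{u}" "{v}"])
       (use uv G in \<open>auto simp: pair_pseudo_graph_iff\<close>)
  then obtain e0 where e0: "e0 \<in> parcs G'" using realisation_heavy_arc[OF G' fY] by blast
  then have M: "0 < ?M" using finite_parcs[OF G'] by (auto simp: card_gt_0_iff)
  \<comment> \<open>The precision \<open>1 / ?M\<close> is the size of the coordinate that
    \<open>realisation_heavy_arc\<close> provides in \<open>G'\<close>.\<close>
  have "\<exists>\<delta>>0. \<forall>x\<in>?X. \<forall>y\<in>?X. (\<forall>v. \<bar>x v - y v\<bar> < \<delta>) \<longrightarrow> (\<forall>e\<in>parcs G'. \<bar>f x e - f y e\<bar> < 1 / ?M)"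
    using M by (intro realisation_uniformly_continuous[OF finite_parcs[OF G] Union_hom_complex hom_complex_subset
          finite_parcs[OF G'] cont]) auto
  then obtain \<delta> where "0 < \<delta>" and \<delta>: "\<And>x y e. x \<in> ?X \<Longrightarrow> y \<in> ?X \<Longrightarrow> (\<And>v. \<bar>x v - y v\<bar> < \<delta>) \<Longrightarrow> e \<in> parcs G' \<Longrightarrow>
      \<bar>f x e - f y e\<bar> < 1 / ?M" by metis
  obtain j :: nat where "4 * (real (card (pverts G)) + 1) / \<delta> < real j" using reals_Archimedean2 by blast
  then have j: "4 * (real (card (pverts G)) + 1) / (real j + 1) < \<delta>"
    using \<open>0 < \<delta>\<close> by (simp add: field_simps)
  show ?thesis
  proof (intro exI[of _ j] allI impI)
    fix I :: "'i pair_pre_digraph"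
    assume I: "pair_pseudo_graph I" and hom: "homomorphic ((cube_graph ^^ j) I) G"
    let ?D = "Domain (parcs I)"
    obtain x where x: "\<And>i. i \<in> ?D \<Longrightarrow> x i \<in> ?X" "\<And>i. i \<in> ?D \<Longrightarrow> flip (x i) \<in> ?X"
      and le: "\<And>i i' e. (i, i') \<in> parcs I \<Longrightarrow>
        \<bar>x i e - flip (x i') e\<bar> \<le> 4 * (real (card (pverts G)) + 1) / (real j + 1)"
      using antipodal_points[OF G I hom] by blast
    have close: "\<bar>x i e - flip (x i') e\<bar> < \<delta>" if "(i, i') \<in> parcs I" for i i' e
      using le[OF that] j by (rule order_le_less_trans)
    \<comment> \<open>\<open>e0\<close> is the default at isolated vertices, which carry no
      point.\<close>
    have "\<exists>e. e \<in> parcs G' \<and> (i \<in> ?D \<longrightarrow> 1 / ?M \<le> f (x i) e)" for i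
      using realisation_heavy_arc[OF G' fY[OF x(1)]] e0 by blast
    then obtain e where e: "\<And>i. e i \<in> parcs G'" "\<And>i. i \<in> ?D \<Longrightarrow> 1 / ?M \<le> f (x i) (e i)" by metis
    have "graph_hom I G' (\<lambda>i. fst (e i))"
      unfolding graph_hom_def
    proof (intro conjI allI impI)
      show "(\<lambda>i. fst (e i)) ` pverts I \<subseteq> pverts G'"
      proof -
        have "e i \<in> pverts G' \<times> pverts G'" for i using e(1) G' by (auto simp: pair_pseudo_graph_iff)
        then show ?thesis by (auto simp: mem_Times_iff)
      qed
    next
      fix i i' assume ii': "(i, i') \<in> parcs I"
      moreover from this have "(i', i) \<in> parcs I" using I by (auto simp: pair_pseudo_graph_iff dest: symD)
      ultimately have D: "i \<in> ?D" "i' \<in> ?D" by blast+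
      obtain a b a' b' where ab: "e i = (a, b)" "e i' = (a', b')" by (metis prod.exhaust)
      \<comment> \<open>At \<open>(b', a')\<close>, \<open>f (flip (x i'))\<close> has the heavy
        coordinate of \<open>f (x i')\<close>, so the nearby \<open>f (x i)\<close> cannot vanish
        there. It does not vanish at \<open>(a, b)\<close> either, and recombining ends gives the
        arc \<open>(a, a')\<close>.\<close>
      have "(b', a') \<in> parcs G'" using e(1)[of i'] G' symD ab by (auto simp: pair_pseudo_graph_iff)
      then have "\<bar>f (x i) (b', a') - f (flip (x i')) (b', a')\<bar> < 1 / ?M"
        using \<delta>[OF x(1)[OF D(1)] x(2)[OF D(2)] close[OF ii']] by blast
      moreover have "f (flip (x i')) (b', a') = f (x i') (e i')"
        using equi[OF x(1)[OF D(2)]] by (simp add: flip_def ab)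
      ultimately have "f (x i) (b', a') \<noteq> 0" using e(2)[OF D(2)] by auto
      moreover have "f (x i) (a, b) \<noteq> 0" using e(2)[OF D(1)] M ab by auto
      ultimately show "(fst (e i), fst (e i')) \<in> parcs G'"
        using realisation_support_arc[OF fY[OF x(1)[OF D(1)]]] ab by auto
    qed
    then show "homomorphic I G'" unfolding homomorphic_def by blast
  qed
qed

section \<open>The reduction\<close>

text \<open>Being an instance is carried through the induction, as
  \<open>poly_time_cube_graph\<close> requires it.\<close>

lemma poly_time_funpow_cube_graph:
  assumes "poly_time (\<lambda>w. graph_code (I w))" and "\<And>w. instance_graph (I w)"
  shows "poly_time (\<lambda>w. graph_code ((cube_graph ^^ j) (I w))) \<and> (\<forall>w. instance_graph ((cube_graph ^^ j) (I w)))"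
  by (induction j) (simp_all add: assms poly_time_cube_graph instance_graph_cube)

theorem theorem4p25:
  fixes G :: "'a pair_pre_digraph" and G' :: "'b pair_pre_digraph"
  assumes "pair_pseudo_graph G" and "pair_pseudo_graph G'"
    and "\<exists>f. Z2_map (realisation (hom_complex G)) flip (realisation (hom_complex G')) flip f"
    and "\<forall>H :: nat pair_pre_digraph.
           pair_pseudo_graph H \<and> \<not> bipartite H \<and> homomorphic H G' \<longrightarrow> NP_hard (PCSP H G')"
  shows "\<forall>H :: 'c pair_pre_digraph.
           pair_pseudo_graph H \<and> \<not> bipartite H \<and> homomorphic H G \<longrightarrow> NP_hard (PCSP H G)"
proof (intro allI impI, elim conjE)
  fix H :: "'c pair_pre_digraph"
  assume H: "pair_pseudo_graph H" "\<not> bipartite H" "homomorphic H G"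
  \<comment> \<open>An edgeless \<open>G\<close> would be bipartite, and then so would
    \<open>H\<close>.\<close>
  have "parcs G \<noteq> {}"
  proof
    assume "parcs G = {}"
    then have "bipartite G" unfolding bipartite_def by (intro exI[of _ "pverts G"] exI[of _ "{}"]) auto
    then show False using bipartite_homomorphic[OF H(3)] H(1,2) by (auto simp: pair_pseudo_graph_iff)
  qed
  then obtain j where j: "\<And>I :: nat pair_pre_digraph. pair_pseudo_graph I \<Longrightarrow>
      homomorphic ((cube_graph ^^ j) I) G \<Longrightarrow> homomorphic I G'"
    using Z2_map_imp_homomorphic[OF assms(1,2)] assms(3) by metis
  obtain H0 :: "nat pair_pre_digraph" where H0: "pair_pseudo_graph H0" "homomorphic H H0" "homomorphic H0 H"
    using relabel_nat[OF H(1)] by blast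
  have "\<not> bipartite H0"
    using bipartite_homomorphic[OF H0(2)] H(1,2) by (auto simp: pair_pseudo_graph_iff)
  then obtain H' :: "nat pair_pre_digraph" where H': "pair_pseudo_graph H'" "\<not> bipartite H'"
    "homomorphic ((cube_graph ^^ j) H') H0"
    using nonbipartite_cube_preimage[OF H0(1)] by blast
  have H'H: "homomorphic ((cube_graph ^^ j) H') H" using H'(3) H0(3) by (rule homomorphic_trans)
  \<comment> \<open>The choice of \<open>j\<close> is applied to \<open>H'\<close> itself, whose
    iterated cube maps to \<open>H\<close> and on to \<open>G\<close>.\<close>
  then have "homomorphic H' G'" using j[OF H'(1)] H(3) homomorphic_trans by blast
  then have hard: "NP_hard (PCSP H' G')" using assms(4) H' by blast
  show "NP_hard (PCSP H G)"
    unfolding NP_hard_def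
  proof (intro allI impI)
    fix L assume "in_NP L"
    with hard obtain f where f: "poly_time f"
      "\<And>w. (w \<in> L \<longrightarrow> f w \<in> fst (PCSP H' G')) \<and> (w \<notin> L \<longrightarrow> f w \<in> snd (PCSP H' G'))"
      unfolding NP_hard_def by blast
    \<comment> \<open>Every value of \<open>f\<close> is a code, so cubing can act on the underlying
      graphs.\<close>
    have "\<exists>I. instance_graph I \<and> f w = graph_code I \<and> (w \<in> L \<longrightarrow> homomorphic I H') \<and> (w \<notin> L \<longrightarrow> \<not> homomorphic I G')" for w
      using f(2)[of w] by (cases "w \<in> L") (auto simp: PCSP_def)
    then obtain I where I: "\<And>w. instance_graph (I w)" "\<And>w. f w = graph_code (I w)"
      "\<And>w. w \<in> L \<Longrightarrow> homomorphic (I w) H'" "\<And>w. w \<notin> L \<Longrightarrow> \<not> homomorphic (I w) G'" by metis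
    have "f = (\<lambda>w. graph_code (I w))" using I(2) by blast
    with f(1) have "poly_time (\<lambda>w. graph_code (I w))" by simp
    note red = poly_time_funpow_cube_graph[OF this I(1), of j]
    have "homomorphic ((cube_graph ^^ j) (I w)) H" if "w \<in> L" for w
      using homomorphic_funpow_cube[OF I(3)[OF that]] H'H by (rule homomorphic_trans)
    \<comment> \<open>NO-instances are preserved by contraposition of the property of
      \<open>j\<close>.\<close>
    moreover have "\<not> homomorphic ((cube_graph ^^ j) (I w)) G" if "w \<notin> L" for w
      using j[of "I w"] I(1)[of w] I(4)[OF that] by (auto simp: instance_graph_def)
    ultimately show "\<exists>f. poly_time f \<and>
        (\<forall>w. (w \<in> L \<longrightarrow> f w \<in> fst (PCSP H G)) \<and> (w \<notin> L \<longrightarrow> f w \<in> snd (PCSP H G)))"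
      using red by (intro exI[of _ "\<lambda>w. graph_code ((cube_graph ^^ j) (I w))"]) (auto simp: PCSP_def)
  qed
qed

end
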